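(* Let $m,k,n$ be positive integers. The following inequalities hold: (1) $\rho(U_{n,k})\le \underline{\rho}(SAT(\mathbb{Z}^m,k,n))$ if $k>n>1$; (2) $\overline{\rho}(SAT(\mathbb{Z}^m,k,n))\le \rho(SAT(\mathbb{Z}^m,k))^n$ if $k\ge n>1$.
   Context: A system of $n$ equations in $k$ variables over the free abelian group $\mathbb{Z}^m$ is written $AX=B$ with $A\in\mathbb{Z}^{n\times k}$, $B\in\mathbb{Z}^{n\times m}$, and is identified with the integer matrix $(A|B)\in\mathbb{Z}^{n(k+m)}$. It is solvable in $\mathbb{Z}^m$ if there is $X\in\mathbb{Z}^{k\times m}$ with $AX=B$. $SAT(\mathbb{Z}^m,k,n)\subset\mathbb{Z}^{n(k+m)}$ is the set of all $(A|B)$ such that $AX=B$ is solvable in $\mathbb{Z}^m$. $SAT(\mathbb{Z}^m,k)\subset\mathbb{Z}^{k+m}$ is the set of all single equations $\gamma_1\mathbf{x}_1+\dots+\gamma_k\mathbf{x}_k=\mathbf{b}$ ($\gamma_j\in\mathbb{Z}$, $\mathbf{b}\in\mathbb{Z}^m$), identified with $(\gamma_1,\dots,\gamma_k,\mathbf{b})$, that are solvable with $\mathbf{x}_j\in\mathbb{Z}^m$. $U_{n,k}\subset\mathbb{Z}^{nk}$ (for $n\le k$) is the set of unimodular $n\times k$ integer matrices, i.e. those of rank $n$ for which the greatest common divisor of all $n\times n$ minors equals $1$. For a positive integer $N$ let $\|v\|_\infty=\max_i|v_i|$ and $B_r^N=\{v\in\mathbb{Z}^N:\|v\|_\infty\le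 r\}$. For $M\subset\mathbb{Z}^N$ put $\rho_r(M)=|M\cap B_r^N|/|B_r^N|$; the asymptotic density is $\rho(M)=\lim_{r\to\infty}\rho_r(M)$ when the limit exists, and the upper and lower asymptotic densities are $\overline{\rho}(M)=\limsup_{r\to\infty}\rho_r(M)$ and $\underline{\rho}(M)=\liminf_{r\to\infty}\rho_r(M)$. The densities $\rho(U_{n,k})$ and $\rho(SAT(\mathbb{Z}^m,k))$ are known to exist (cited by the paper): with $\zeta$ the Riemann zeta-function, $\rho(U_{n,k})=\left(\prod_{j=k-n+1}^{k}\zeta(j)\right)^{-1}$ for $k>n\ge1$ (Maze, Rosenthal, Wagner), and $\rho(SAT(\mathbb{Z}^m,k))=\zeta(k+m)/\zeta(k)$ for $k\ge2$ (Gilman, Myasnikov, Roman'kov). *)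

theory Defs
  imports
    "HOL-Analysis.Analysis"
    "Jordan_Normal_Form.DL_Rank_Submatrix"
begin

(* Elements of Z^N are vectors of type int vec of dimension N. *)

(* Intended for vectors of positive dimension: Max of the empty set is unspecified. *)
definition sup_norm :: "int vec \<Rightarrow> int" where
  "sup_norm v = Max {\<bar>v $ i\<bar> | i. i < dim_vec v}"

definition int_ball :: "nat \<Rightarrow> nat \<Rightarrow> int vec set" where
  "int_ball N r = {v \<in> carrier_vec N. sup_norm v \<le> int r}"

definition ball_density :: "nat \<Rightarrow> int vec set \<Rightarrow> nat \<Rightarrow> real" where
  "ball_density N M r = real (card (M \<inter> int_ball N r)) / real (card (int_ball N r))"

(* Meaningful only if the limit exists: lim is a definite description. *)
definition asymp_density :: "nat \<Rightarrow> int vec set \<Rightarrow> real" where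
  "asymp_density N M = lim (ball_density N M)"

definition upper_asymp_density :: "nat \<Rightarrow> int vec set \<Rightarrow> ereal" where
  "upper_asymp_density N M = limsup (\<lambda>r. ereal (ball_density N M r))"

definition lower_asymp_density :: "nat \<Rightarrow> int vec set \<Rightarrow> ereal" where
  "lower_asymp_density N M = liminf (\<lambda>r. ereal (ball_density N M r))"

(* Row-by-row identification of integer p x q matrices with Z^(p q). *)
definition flatten_mat :: "int mat \<Rightarrow> int vec" where
  "flatten_mat A = vec (dim_row A * dim_col A) (\<lambda>l. A $$ (l div dim_col A, l mod dim_col A))"

(* The block matrix (A|B), for A and B with the same number of rows. *)
definition augment :: "int mat \<Rightarrow> int mat \<Rightarrow> int mat" where
  "augment A B = mat (dim_row A) (dim_col A + dim_col B)
     (\<lambda>(i, j). if j < dim_col A then A $$ (i, j) else B $$ (i, j - dim_col A))"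

definition SAT_system :: "nat \<Rightarrow> nat \<Rightarrow> nat \<Rightarrow> int vec set" where
  "SAT_system m k n = {flatten_mat (augment A B) | A B.
     A \<in> carrier_mat n k \<and> B \<in> carrier_mat n m \<and> (\<exists>X \<in> carrier_mat k m. A * X = B)}"

definition SAT_single :: "nat \<Rightarrow> nat \<Rightarrow> int vec set" where
  "SAT_single m k = {c @\<^sub>v b | c b.
     c \<in> carrier_vec k \<and> b \<in> carrier_vec m \<and>
     (\<exists>x :: nat \<Rightarrow> int vec. (\<forall>j<k. x j \<in> carrier_vec m) \<and>
        finsum_vec TYPE(int) m (\<lambda>j. c $ j \<cdot>\<^sub>v x j) {..<k} = b)}"

definition maximal_minors :: "int mat \<Rightarrow> int set" where
  "maximal_minors A = {det (submatrix A UNIV J) | J. J \<subseteq> {..<dim_col A} \<and> card J = dim_row A}"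

(* The rank is that of A as a rational matrix; the first argument of
   vec_space.rank is the dimension of the column vectors. *)
definition unimodular_mats :: "nat \<Rightarrow> nat \<Rightarrow> int mat set" where
  "unimodular_mats n k = {A \<in> carrier_mat n k.
     vec_space.rank n (map_mat rat_of_int A) = n \<and> Gcd (maximal_minors A) = 1}"

definition U_set :: "nat \<Rightarrow> nat \<Rightarrow> int vec set" where
  "U_set n k = flatten_mat ` unimodular_mats n k"

end

theory Submission
  imports Defs "HOL-Number_Theory.Cong"
begin

text \<open>
  For a fixed radius both inequalities are inequalities between cardinalities. If the maximal
  minors of an \<open>n \<times> k\<close> matrix \<open>A\<close> have gcd 1, then \<open>A\<close> has an integer right inverse \<open>Y\<close>: the
  integers \<open>d\<close> for which \<open>A * Y = d \<cdot> 1\<close> has a solution form an ideal, and this ideal contains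
  every maximal minor because of the adjugate. Then \<open>A X = B\<close> has the solution \<open>X = Y B\<close> for
  every \<open>B\<close>, so a unimodular \<open>A\<close> and an arbitrary \<open>B\<close> give a solvable system
  (\<open>U_density_le_SAT_system_density\<close>). In the other direction, each row of a solvable system is
  a solvable single equation (\<open>SAT_system_density_le_SAT_single_density_power\<close>). Passing to the
  limit proves the theorem, once the limits defining the densities of the unimodular matrices
  and of the solvable single equations are known to exist. That is where the work lies.

  A single equation is solvable iff the gcd of its coefficients divides the coordinates of its
  right-hand side, and a matrix is unimodular iff no prime divides all its maximal minors.
  Imposing such a condition only modulo a fixed integer \<open>q\<close> defines a larger set that is
  periodic modulo \<open>q\<close>, and periodic sets have a density (\<open>periodic_density_convergent\<close>). It
  therefore suffices that the points that are lost in the passage from the periodic set to the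
  original one have small upper density (\<open>density_convergent_if_approximable_above\<close>). At such a
  point the condition fails because of a divisor \<open>d\<close> larger than a bound \<open>M\<close> that can be chosen
  at will.

  These points are counted in fibres in which all but two coordinates \<open>x\<close>, \<open>y\<close> are fixed. In
  both problems the failure at \<open>d\<close> implies that \<open>d\<close> divides two linear forms \<open>a x + b\<close> and
  \<open>a y + c\<close> whose common leading coefficient is coprime to \<open>d\<close>. If \<open>d\<close> is at most the radius
  \<open>r\<close>, these are two independent conditions of probability about \<open>1 / d\<close> each, and the sum of
  \<open>1 / d\<^sup>2\<close> over \<open>d > M\<close> is at most \<open>1 / M\<close>. If \<open>d > r\<close>, then for a single equation
  \<open>a = 1\<close> and \<open>b = c = 0\<close>, so that \<open>x = y = 0\<close>. For matrices \<open>d\<close> is a prime, \<open>a x + b\<close> is a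
  minor and hence bounded by a fixed power of \<open>r\<close>, so that for each \<open>x\<close> either \<open>a x + b = 0\<close>
  or only boundedly many primes \<open>d > r\<close> come into question, each of them allowing at most three
  values of \<open>y\<close>; this amounts to \<open>O(r)\<close> of the \<open>(2 r + 1)\<^sup>2\<close> pairs
  (\<open>card_common_prime_divisor_le\<close>).

  For matrices the linear forms arise as follows. Suppose that the prime \<open>p\<close> divides all maximal
  minors, and let \<open>i\<close> be the first row that is dependent modulo \<open>p\<close> on the rows above it. Some
  minor \<open>a\<close> formed from the rows above is not divisible by \<open>p\<close>, but all minors obtained from it
  by adding row \<open>i\<close> and one more column \<open>j\<close> are. By cofactor expansion such a minor is a linear
  form, with leading coefficient \<open>a\<close>, in the entry of row \<open>i\<close> and column \<open>j\<close>. Since \<open>n < k\<close>,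
  at least two columns \<open>j\<close> are available (\<open>first_rank_drop\<close>).
\<close>

section \<open>Points of a box\<close>

definition box :: "nat \<Rightarrow> nat \<Rightarrow> (nat \<Rightarrow> int) set" where
  "box N r = {..<N} \<rightarrow>\<^sub>E {- int r..int r}"

lemma finite_filter_int_interval [simp]: "finite {x. - int r \<le> x \<and> x \<le> int r \<and> P x}"
  by (rule finite_subset[of _ "{- int r..int r}"]) auto

lemma finite_box: "finite (box N r)"
  unfolding box_def by (intro finite_PiE) auto

lemma card_box: "card (box N r) = (2 * r + 1) ^ N"
proof -
  have "nat (2 * int r + 1) = 2 * r + 1" by linarith
  then show ?thesis unfolding box_def by (simp add: card_PiE)
qed

lemma mem_int_ball_iff:
  assumes "N > 0"
  shows "v \<in> int_ball N r \<longleftrightarrow> v \<in> carrier_vec N \<and> (\<forall>i<N. \<bar>v $ i\<bar> \<le> int r)"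
proof -
  have "sup_norm v \<le> int r \<longleftrightarrow> (\<forall>i<N. \<bar>v $ i\<bar> \<le> int r)" if "v \<in> carrier_vec N"
  proof -
    have "{\<bar>v $ i\<bar> | i. i < dim_vec v} = (\<lambda>i. \<bar>v $ i\<bar>) ` {..<N}"
      using that by auto
    then show ?thesis using assms unfolding sup_norm_def by (simp add: lessThan_empty_iff) blast
  qed
  then show ?thesis unfolding int_ball_def by auto
qed

lemma int_ball_eq_box:
  assumes "N > 0"
  shows "int_ball N r = vec N ` box N r"
proof -
  have "v \<in> vec N ` box N r" if v: "v \<in> carrier_vec N" "\<forall>i<N. \<bar>v $ i\<bar> \<le> int r" for v
  proof (rule image_eqI)
    show "v = vec N (restrict (\<lambda>i. v $ i) {..<N})" using v(1) by auto
    show "restrict (\<lambda>i. v $ i) {..<N} \<in> box N r"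
      using v(2) unfolding box_def by (simp add: abs_le_iff minus_le_iff)
  qed
  moreover have "\<forall>i<N. \<bar>vec N f $ i\<bar> \<le> int r" if "f \<in> box N r" for f
    using that unfolding box_def by (simp add: abs_le_iff PiE_iff minus_le_iff)
  ultimately show ?thesis using mem_int_ball_iff[OF assms] by auto
qed

lemma inj_vec_box: "inj_on (vec N) (box N r)"
proof (rule inj_onI)
  fix f g assume fg: "f \<in> box N r" "g \<in> box N r" and eq: "vec N f = vec N g"
  have "f i = g i" if "i < N" for i
    using arg_cong[OF eq, of "\<lambda>v. v $ i"] that by simp
  then show "f = g" using fg unfolding box_def by (intro PiE_ext) auto
qed

lemma card_Int_int_ball:
  assumes "N > 0"
  shows "card (M \<inter> int_ball N r) = card {f \<in> box N r. vec N f \<in> M}"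
proof -
  have "M \<inter> int_ball N r = vec N ` {f \<in> box N r. vec N f \<in> M}"
    using int_ball_eq_box[OF assms] by auto
  moreover have "inj_on (vec N) {f \<in> box N r. vec N f \<in> M}"
    by (rule inj_on_subset[OF inj_vec_box]) auto
  ultimately show ?thesis by (simp add: card_image)
qed

lemma finite_int_ball: "N > 0 \<Longrightarrow> finite (int_ball N r)"
  by (simp add: int_ball_eq_box finite_box)

lemma card_int_ball: "N > 0 \<Longrightarrow> card (int_ball N r) = (2 * r + 1) ^ N"
  by (simp add: int_ball_eq_box card_image[OF inj_vec_box] card_box)

lemma ball_density_eq:
  assumes "N > 0"
  shows "ball_density N M r = real (card {f \<in> box N r. vec N f \<in> M}) / (2 * real r + 1) ^ N"
  unfolding ball_density_def card_Int_int_ball[OF assms] card_int_ball[OF assms] by (simp add: add.commute)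

section \<open>Residue classes and periodic sets\<close>

text \<open>
  The class consists of the points \<open>q * t + c\<close> for \<open>t\<close> in an interval, whose length is the
  difference of two floors.
\<close>
lemma card_residue_class:
  fixes q c :: int
  assumes q: "q > 0" and c: "0 \<le> c" "c < q"
  shows "\<bar>real (card {x \<in> {- int r..int r}. x mod q = c}) - (2 * real r + 1) / real_of_int q\<bar> \<le> 1"
proof -
  define lo where "lo = (- int r - c - 1) div q + 1"
  define hi where "hi = (int r - c) div q"
  have "{x \<in> {- int r..int r}. x mod q = c} = (\<lambda>t. q * t + c) ` {lo..hi}" (is "?L = ?R")
  proof (intro equalityI subsetI)
    fix x assume x: "x \<in> ?L"
    then have xe: "x = q * (x div q) + c" by (metis (mono_tags, lifting) mem_Collect_eq mult_div_mod_eq)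
    have "x div q \<le> hi" unfolding hi_def
      using x xe q by (intro zdiv_mono1[of "q * (x div q)" "int r - c" q, simplified]) auto
    moreover have "lo \<le> x div q"
    proof -
      have "(- int r - c - 1) < q * (x div q)" using x xe by auto
      then have "(- int r - c - 1) div q < x div q"
        using mult_div_mod_eq[of q "- int r - c - 1"] pos_mod_sign[OF q, of "- int r - c - 1"] q
        by (smt (verit) mult_less_cancel_left_pos)
      then show ?thesis unfolding lo_def by simp
    qed
    ultimately show "x \<in> ?R" using xe by auto
  next
    fix x assume "x \<in> ?R"
    then obtain t where t: "lo \<le> t" "t \<le> hi" and x: "x = q * t + c" by auto
    have "q * t \<le> q * hi" using t q by simp
    moreover have "q * hi \<le> int r - c" unfolding hi_def
      using mult_div_mod_eq[of q "int r - c"] pos_mod_sign[OF q, of "int r - c"] by linarith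
    moreover have "q * lo \<le> q * t" using t q by simp
    moreover have "q * lo \<ge> - int r - c" unfolding lo_def
      using mult_div_mod_eq[of q "- int r - c - 1"] pos_mod_bound[OF q, of "- int r - c - 1"]
      unfolding distrib_left by linarith
    ultimately have "- int r \<le> x" "x \<le> int r" using x by linarith+
    then show "x \<in> ?L" using x c by simp
  qed
  moreover have "inj_on (\<lambda>t. q * t + c) {lo..hi}" using q by (auto simp: inj_on_def)
  ultimately have card: "card {x \<in> {- int r..int r}. x mod q = c} = nat (hi - lo + 1)"
    by (simp add: card_image)
  let ?u = "real_of_int (int r - c) / real_of_int q"
  let ?l = "real_of_int (- int r - c - 1) / real_of_int q"
  have hi: "hi = \<lfloor>?u\<rfloor>" and lo: "lo - 1 = \<lfloor>?l\<rfloor>"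
    unfolding hi_def lo_def by (simp_all only: floor_divide_of_int_eq add_diff_cancel_right')
  have diff: "?u - ?l = (2 * real r + 1) / real_of_int q" 
    by (simp add: diff_divide_distrib[symmetric])
  have "?l \<le> ?u" using q by (intro divide_right_mono) auto
  then have "lo - 1 \<le> hi" unfolding hi lo by (rule floor_mono)
  then have "real (nat (hi - lo + 1)) = real_of_int hi - real_of_int (lo - 1)" by simp
  then show ?thesis unfolding card diff[symmetric] hi lo by linarith
qed

lemma card_residue_class_le:
  fixes q c :: int
  assumes q: "q > 0"
  shows "real (card {x \<in> {- int r..int r}. x mod q = c}) \<le> (2 * real r + 1) / real_of_int q + 1"
proof (cases "0 \<le> c \<and> c < q")
  case True
  then show ?thesis using card_residue_class[OF q, of c r] by (auto simp: abs_le_iff)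
next
  case False
  then have none: "{x \<in> {- int r..int r}. x mod q = c} = {}" using q by auto
  show ?thesis unfolding none using q by simp
qed

lemma residue_class_density:
  fixes q c :: int
  assumes q: "q > 0" and c: "0 \<le> c" "c < q"
  shows "(\<lambda>r. real (card {x \<in> {- int r..int r}. x mod q = c}) / (2 * real r + 1))
           \<longlonglongrightarrow> 1 / real_of_int q"
proof (rule LIM_zero_cancel, rule Lim_null_comparison)
  show "\<forall>\<^sub>F r in sequentially. norm (real (card {x \<in> {- int r..int r}. x mod q = c}) / (2 * real r + 1)
      - 1 / real_of_int q) \<le> 1 / (2 * real r + 1)"
  proof (intro always_eventually allI)
    fix r
    let ?n = "real (card {x \<in> {- int r..int r}. x mod q = c})"
    have "?n / (2 * real r + 1) - 1 / real_of_int q = (?n - (2 * real r + 1) / real_of_int q) / (2 * real r + 1)"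
      using q by (simp add: field_simps)
    then show "norm (?n / (2 * real r + 1) - 1 / real_of_int q) \<le> 1 / (2 * real r + 1)"
      using card_residue_class[OF assms, of r] by (simp add: abs_divide divide_right_mono)
  qed
  show "(\<lambda>r. 1 / (2 * real r + 1)) \<longlonglongrightarrow> 0" by real_asymp
qed

text \<open>
  A periodic set is a finite union of products of residue classes, one for each coordinate,
  and the proportion of such a product in a box tends to \<open>1 / q ^ N\<close>.
\<close>
lemma periodic_density_convergent:
  fixes q :: int
  assumes N: "N > 0" and q: "q > 0"
    and per: "\<And>f g. (\<And>i. i < N \<Longrightarrow> f i mod q = g i mod q) \<Longrightarrow> vec N f \<in> P \<Longrightarrow> vec N g \<in> P"
  shows "convergent (ball_density N P)"
proof -
  define C where "C = {c \<in> {..<N} \<rightarrow>\<^sub>E {0..<q}. vec N c \<in> P}"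
  define R where "R r c = PiE {..<N} (\<lambda>i. {x \<in> {- int r..int r}. x mod q = c i})" for r and c :: "nat \<Rightarrow> int"
  have finC: "finite C" unfolding C_def 
    by (rule finite_subset[of _ "{..<N} \<rightarrow>\<^sub>E {0..<q}"]) (auto intro!: finite_PiE)
  have split: "{f \<in> box N r. vec N f \<in> P} = (\<Union>c\<in>C. R r c)" for r
  proof (intro equalityI subsetI)
    fix f assume f: "f \<in> {f \<in> box N r. vec N f \<in> P}"
    define c where "c = restrict (\<lambda>i. f i mod q) {..<N}"
    have "vec N c \<in> P" using f by (intro per[of f c]) (auto simp: c_def)
    then have "c \<in> C" using q by (auto simp: C_def c_def)
    moreover have "f \<in> R r c" using f by (auto simp: R_def c_def box_def PiE_iff)
    ultimately show "f \<in> (\<Union>c\<in>C. R r c)" by blast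
  next
    fix f assume "f \<in> (\<Union>c\<in>C. R r c)"
    then obtain c where c: "c \<in> C" "f \<in> R r c" by blast
    have "c i mod q = f i mod q" if "i < N" for i
      using c that by (auto simp: R_def C_def PiE_iff)
    then have "vec N f \<in> P" using c by (intro per[of c f]) (auto simp: C_def)
    then show "f \<in> {f \<in> box N r. vec N f \<in> P}" using c by (auto simp: R_def box_def PiE_iff)
  qed
  have disj: "R r c \<inter> R r c' = {}" if "c \<in> C" "c' \<in> C" "c \<noteq> c'" for r c c'
  proof (rule ccontr)
    assume "R r c \<inter> R r c' \<noteq> {}"
    then obtain f where "f \<in> R r c" "f \<in> R r c'" by blast
    then have "c i = c' i" if "i < N" for i using that by (auto simp: R_def PiE_iff)
    then show False using that by (auto simp: C_def intro!: PiE_ext[of c "{..<N}" _ c' ])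
  qed
  have finR: "finite (R r c)" for r c
    unfolding R_def by (intro finite_PiE) auto
  have "ball_density N P r
      = (\<Sum>c\<in>C. \<Prod>i<N. real (card {x \<in> {- int r..int r}. x mod q = c i}) / (2 * real r + 1))" for r
  proof -
    have "card {f \<in> box N r. vec N f \<in> P} = (\<Sum>c\<in>C. card (R r c))"
      unfolding split using finC finR disj by (intro card_UN_disjoint) blast+
    then show ?thesis unfolding ball_density_eq[OF N]
      by (simp add: R_def card_PiE prod_dividef sum_divide_distrib)
  qed
  moreover have "(\<lambda>r. \<Sum>c\<in>C. \<Prod>i<N. real (card {x \<in> {- int r..int r}. x mod q = c i}) / (2 * real r + 1))
      \<longlonglongrightarrow> (\<Sum>c\<in>C. \<Prod>i<N. 1 / real_of_int q)"
    by (intro tendsto_sum tendsto_prod residue_class_density q) (auto simp: C_def PiE_iff)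
  ultimately have "ball_density N P \<longlonglongrightarrow> (\<Sum>c\<in>C. \<Prod>i<N. 1 / real_of_int q)"
    by presburger
  then show ?thesis by (rule convergentI)
qed

text \<open>
  A uniform limit of Cauchy sequences is a Cauchy sequence. The approximation is only required
  for large radii, with a threshold that may depend on the approximating set.
\<close>
lemma density_convergent_if_approximable:
  assumes "\<And>e. e > 0 \<Longrightarrow> \<exists>P. convergent (ball_density N P) \<and>
      (\<forall>\<^sub>F r in sequentially. \<bar>ball_density N P r - ball_density N M r\<bar> \<le> e)"
  shows "convergent (ball_density N M)"
proof (rule real_Cauchy_convergent, rule metric_CauchyI)
  fix e :: real assume e: "e > 0"
  then obtain P where "convergent (ball_density N P)"
    and "\<forall>\<^sub>F r in sequentially. \<bar>ball_density N P r - ball_density N M r\<bar> \<le> e / 4"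
    using assms[of "e / 4"] by auto
  then obtain m1 m2 where
    m1: "\<forall>r\<ge>m1. \<forall>s\<ge>m1. dist (ball_density N P r) (ball_density N P s) < e / 4"
    and m2: "\<forall>r\<ge>m2. \<bar>ball_density N P r - ball_density N M r\<bar> \<le> e / 4"
    using e metric_CauchyD[OF convergent_Cauchy, of "ball_density N P" "e / 4"]
    unfolding eventually_sequentially by auto
  have "dist (ball_density N M r) (ball_density N M s) < e" if "r \<ge> max m1 m2" "s \<ge> max m1 m2" for r s
  proof -
    have "\<bar>ball_density N P r - ball_density N P s\<bar> < e / 4"
      "\<bar>ball_density N P r - ball_density N M r\<bar> \<le> e / 4"
      "\<bar>ball_density N P s - ball_density N M s\<bar> \<le> e / 4"
      using m1 m2 that by (auto simp: dist_real_def)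
    then show ?thesis unfolding dist_real_def by linarith
  qed
  then show "\<exists>m. \<forall>r\<ge>m. \<forall>s\<ge>m. dist (ball_density N M r) (ball_density N M s) < e" by blast
qed

lemma density_convergent_if_approximable_above:
  assumes N: "N > 0"
    and "\<And>e. e > 0 \<Longrightarrow> \<exists>P. M \<subseteq> P \<and> convergent (ball_density N P) \<and>
      (\<forall>\<^sub>F r in sequentially. ball_density N (P - M) r \<le> e)"
  shows "convergent (ball_density N M)"
proof (rule density_convergent_if_approximable)
  fix e :: real assume "e > 0"
  from assms(2)[OF this] obtain P where P: "M \<subseteq> P" "convergent (ball_density N P)"
      "\<forall>\<^sub>F r in sequentially. ball_density N (P - M) r \<le> e" by blast
  have "ball_density N P r - ball_density N M r = ball_density N (P - M) r" for r
  proof -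
    have "P \<inter> int_ball N r = (M \<inter> int_ball N r) \<union> ((P - M) \<inter> int_ball N r)" using P(1) by auto
    then have "card (P \<inter> int_ball N r) = card (M \<inter> int_ball N r) + card ((P - M) \<inter> int_ball N r)"
      using finite_int_ball[OF N] by (simp only:) (rule card_Un_disjoint, auto)
    then show ?thesis unfolding ball_density_def by (simp add: diff_divide_distrib[symmetric])
  qed
  moreover have "ball_density N (P - M) r \<ge> 0" for r unfolding ball_density_def by simp
  ultimately show "\<exists>P. convergent (ball_density N P) \<and>
      (\<forall>\<^sub>F r in sequentially. \<bar>ball_density N P r - ball_density N M r\<bar> \<le> e)"
    using P by (intro exI[of _ P]) simp
qed

section \<open>Fibres in two coordinate directions\<close>

text \<open>
  Averaging over all points of the box: the fibre count at \<open>f\<close> is the number of ways to replace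
  the coordinates \<open>l1\<close> and \<open>l2\<close> of \<open>f\<close> so that the result lies in the set, and every point of
  the set is hit by \<open>(2 * r + 1)\<^sup>2\<close> such replacements.
\<close>
lemma density_le_if_slices_le:
  assumes N: "N > 0" and l: "l1 < N" "l2 < N" "l1 \<noteq> l2" 
    and slice: "\<And>f. f \<in> box N r \<Longrightarrow>
      real (card {(x, y) \<in> {- int r..int r} \<times> {- int r..int r}. vec N (f(l1 := x, l2 := y)) \<in> M})
        \<le> t * (2 * real r + 1)\<^sup>2"
  shows "ball_density N M r \<le> t"
proof -
  let ?I = "{- int r..int r} \<times> {- int r..int r}"
  define S where "S = {f \<in> box N r. vec N f \<in> M}"
  define T where "T f = {(x, y) \<in> ?I. vec N (f(l1 := x, l2 := y)) \<in> M}" for f :: "nat \<Rightarrow> int"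
  have upd: "f(l1 := x, l2 := y) \<in> box N r" if "f \<in> box N r" "(x, y) \<in> ?I" for f x y
    using that l unfolding box_def by (auto simp: PiE_iff extensional_def)
  have vals: "(f l1, f l2) \<in> ?I" if "f \<in> box N r" for f
    using that l unfolding box_def by (auto simp: PiE_iff)
  \<comment> \<open>Exchanging the two coordinates of \<open>f\<close> with the pair \<open>(x, y)\<close> is an involution.\<close>
  let ?h = "\<lambda>(f, x, y). (f(l1 := x, l2 := y), f l1, f l2) :: (nat \<Rightarrow> int) \<times> int \<times> int"
  have "bij_betw ?h (SIGMA f:box N r. T f) (S \<times> ?I)"
  proof (rule bij_betwI[where g = ?h])
    show "?h \<in> (SIGMA f:box N r. T f) \<rightarrow> S \<times> ?I"
      using upd vals unfolding S_def T_def by auto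
    show "?h \<in> S \<times> ?I \<rightarrow> (SIGMA f:box N r. T f)"
    proof (rule Pi_I)
      fix z assume "z \<in> S \<times> ?I"
      then obtain f x y where z: "z = (f, x, y)" and "f \<in> S" "(x, y) \<in> ?I" by auto
      then have "f(l1 := x, l2 := y) \<in> box N r" "(f l1, f l2) \<in> ?I" "vec N f \<in> M"
        using upd vals unfolding S_def by auto
      moreover have "(f(l1 := x, l2 := y))(l1 := f l1, l2 := f l2) = f" using l by auto
      ultimately show "?h z \<in> (SIGMA f:box N r. T f)"
        unfolding z T_def by (simp only: mem_Sigma_iff mem_Collect_eq case_prod_conv simp_thms)
    qed
  qed (use l in auto)
  then have "card (SIGMA f:box N r. T f) = card (S \<times> ?I)" by (rule bij_betw_same_card)
  moreover have "finite (T f)" for f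
    by (rule finite_subset[of _ ?I]) (auto simp: T_def)
  then have "card (SIGMA f:box N r. T f) = (\<Sum>f\<in>box N r. card (T f))"
    by (intro card_SigmaI finite_box) auto
  moreover have "card (S \<times> ?I) = card S * (2 * r + 1)\<^sup>2"
  proof -
    have "nat (2 * int r + 1) = 2 * r + 1" by linarith
    then show ?thesis by (simp add: card_cartesian_product power2_eq_square)
  qed
  ultimately have "card S * (2 * r + 1)\<^sup>2 = (\<Sum>f\<in>box N r. card (T f))" by simp
  then have "real (card S * (2 * r + 1)\<^sup>2) = real (\<Sum>f\<in>box N r. card (T f))" by (rule arg_cong)
  then have "real (card S) * (2 * real r + 1)\<^sup>2 = (\<Sum>f\<in>box N r. real (card (T f)))"
    by (simp add: add.commute)
  also have "\<dots> \<le> (\<Sum>f\<in>box N r. t * (2 * real r + 1)\<^sup>2)"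
    using slice unfolding T_def by (intro sum_mono) auto
  also have "\<dots> = t * (2 * real r + 1) ^ N * (2 * real r + 1)\<^sup>2"
    by (simp add: card_box algebra_simps)
  finally have "real (card S) \<le> t * (2 * real r + 1) ^ N"
    by (rule mult_right_le_imp_le) simp
  then show ?thesis unfolding ball_density_eq[OF N] S_def by (simp add: divide_simps)
qed

section \<open>Two linear forms with a large common divisor\<close>

text \<open>
  Two solutions differ by a multiple of \<open>d\<close>, so they lie in a single residue class.
\<close>
lemma card_linear_congruence_le:
  fixes a b :: int and d :: nat
  assumes d: "d > 0" and cop: "coprime (int d) a"
  shows "real (card {x \<in> {- int r..int r}. int d dvd a * x + b}) \<le> (2 * real r + 1) / real d + 1"
proof (cases "{x \<in> {- int r..int r}. int d dvd a * x + b} = {}")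
  case True
  show ?thesis unfolding True using d by simp
next
  case False
  then obtain z where z: "int d dvd a * z + b" by blast
  have "x mod int d = z mod int d" if "int d dvd a * x + b" for x
  proof -
    have "int d dvd (a * x + b) - (a * z + b)" using that z by (rule dvd_diff)
    then have "int d dvd a * (x - z)" by (simp add: algebra_simps)
    then have "int d dvd x - z" using cop by (simp add: coprime_dvd_mult_right_iff)
    then show ?thesis by (simp add: mod_eq_dvd_iff)
  qed
  then have "{x \<in> {- int r..int r}. int d dvd a * x + b} \<subseteq> {x \<in> {- int r..int r}. x mod int d = z mod int d}"
    by auto
  then have "card {x \<in> {- int r..int r}. int d dvd a * x + b} \<le> card {x \<in> {- int r..int r}. x mod int d = z mod int d}"
    by (intro card_mono) auto
  then show ?thesis using card_residue_class_le[of "int d" r "z mod int d"] d by simp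
qed

lemma sum_inverse_squares_le:
  assumes "n > 0"
  shows "(\<Sum>d\<in>{n<..m}. 1 / (real d)\<^sup>2) \<le> 1 / real n"
proof -
  have "(\<Sum>d\<in>{n<..m}. 1 / (real d)\<^sup>2) \<le> 1 / real n - 1 / real m" if "n \<le> m"
    using that
  proof (induction m rule: dec_induct)
    case (step m)
    have "{n<..Suc m} = insert (Suc m) {n<..m}" using step by auto
    moreover have "1 / (real (Suc m))\<^sup>2 \<le> 1 / real m - 1 / real (Suc m)"
    proof -
      have m: "real m > 0" using assms step by simp
      have "1 / (real (Suc m))\<^sup>2 \<le> 1 / (real m * real (Suc m))"
        using m by (intro divide_left_mono) (auto simp: power2_eq_square)
      also have "\<dots> = 1 / real m - 1 / real (Suc m)" using m by (simp add: field_simps)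
      finally show ?thesis .
    qed
    ultimately show ?case using step by simp
  qed simp
  then show ?thesis by (cases "n \<le> m") (auto intro: order_trans)
qed

text \<open>
  For \<open>d \<le> r\<close> a residue class modulo \<open>d\<close> takes up a proportion of at most \<open>2 / d\<close> of the
  interval, so each \<open>d\<close> contributes at most a proportion of \<open>4 / d\<^sup>2\<close> of the pairs. This fails for
  divisors much larger than \<open>r\<close>, since their residue classes may still contain a point.
\<close>
lemma card_common_divisor_le_radius:
  fixes a b c :: int
  assumes n: "n > 0"
  shows "real (card {(x, y) \<in> {- int r..int r} \<times> {- int r..int r}.
      \<exists>d\<in>{n<..r}. coprime (int d) a \<and> int d dvd a * x + b \<and> int d dvd a * y + c})
    \<le> 4 / real n * (2 * real r + 1)\<^sup>2"
proof -
  define X where "X d e = {x \<in> {- int r..int r}. int d dvd a * x + e}" for d e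
  have finX: "finite (X d e)" for d e unfolding X_def by auto
  define D where "D = {d \<in> {n<..r}. coprime (int d) a}"
  have cardX: "real (card (X d e)) \<le> 2 * (2 * real r + 1) / real d" if "d \<in> D" for d e
  proof -
    have d: "d > 0" "d \<le> r" "coprime (int d) a" using that unfolding D_def by auto
    have "real (card (X d e)) \<le> (2 * real r + 1) / real d + 1"
      unfolding X_def using card_linear_congruence_le d by blast
    also have "1 \<le> (2 * real r + 1) / real d" using d by (simp add: field_simps)
    then have "(2 * real r + 1) / real d + 1 \<le> 2 * (2 * real r + 1) / real d"
      by (simp add: add_divide_distrib)
    finally show ?thesis .
  qed
  have "{(x, y) \<in> {- int r..int r} \<times> {- int r..int r}.
      \<exists>d\<in>{n<..r}. coprime (int d) a \<and> int d dvd a * x + b \<and> int d dvd a * y + c}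
      = (\<Union>d\<in>D. X d b \<times> X d c)" unfolding X_def D_def by auto
  moreover have "real (card (\<Union>d\<in>D. X d b \<times> X d c)) \<le> 4 * (2 * real r + 1)\<^sup>2 * (1 / real n)"
  proof -
    have "card (\<Union>d\<in>D. X d b \<times> X d c) \<le> (\<Sum>d\<in>D. card (X d b \<times> X d c))"
      by (intro card_UN_le) (simp add: D_def)
    then have "real (card (\<Union>d\<in>D. X d b \<times> X d c)) \<le> real (\<Sum>d\<in>D. card (X d b \<times> X d c))"
      by (simp only: of_nat_le_iff)
    also have "real (\<Sum>d\<in>D. card (X d b \<times> X d c)) \<le> (\<Sum>d\<in>D. 4 * (2 * real r + 1)\<^sup>2 * (1 / (real d)\<^sup>2))"
      unfolding of_nat_sum
    proof (rule sum_mono)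
      fix d assume d: "d \<in> D"
      have "real (card (X d b)) * real (card (X d c)) \<le> (2 * (2 * real r + 1) / real d) * (2 * (2 * real r + 1) / real d)"
        using cardX[OF d] by (intro mult_mono) auto
      also have "\<dots> = 4 * (2 * real r + 1)\<^sup>2 * (1 / (real d)\<^sup>2)"
        by (simp add: power2_eq_square algebra_simps add_divide_distrib)
      finally show "real (card (X d b \<times> X d c)) \<le> 4 * (2 * real r + 1)\<^sup>2 * (1 / (real d)\<^sup>2)"
        by (simp add: card_cartesian_product)
    qed
    also have "(\<Sum>d\<in>D. 4 * (2 * real r + 1)\<^sup>2 * (1 / (real d)\<^sup>2)) \<le> 4 * (2 * real r + 1)\<^sup>2 * (1 / real n)"
    proof -
      have "(\<Sum>d\<in>D. 1 / (real d)\<^sup>2) \<le> (\<Sum>d\<in>{n<..r}. 1 / (real d)\<^sup>2)"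
        unfolding D_def by (intro sum_mono2) auto
      also have "\<dots> \<le> 1 / real n" by (rule sum_inverse_squares_le[OF n])
      finally show ?thesis unfolding sum_distrib_left[symmetric] by (intro mult_left_mono) auto
    qed
    finally show ?thesis .
  qed
  ultimately show ?thesis by simp
qed

text \<open>
  The product of distinct prime divisors divides \<open>z\<close>.
\<close>
lemma card_large_prime_divisors_le:
  fixes z :: int
  assumes z: "z \<noteq> 0" "\<bar>z\<bar> \<le> int r ^ K" and r: "r > 0"
  shows "finite {p. prime p \<and> r < p \<and> int p dvd z}" and "card {p. prime p \<and> r < p \<and> int p dvd z} \<le> K"
proof -
  let ?Q = "{p. prime p \<and> r < p \<and> int p dvd z}"
  have nz: "nat \<bar>z\<bar> \<noteq> 0" using z by simp
  have sub: "?Q \<subseteq> prime_factors (nat \<bar>z\<bar>)"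
    using z by (auto simp: prime_factors_dvd int_dvd_int_iff[symmetric])
  then show fin: "finite ?Q" by (rule finite_subset) simp
  have "(r + 1) ^ card ?Q \<le> (\<Prod>p\<in>?Q. p)"
    using prod_mono[of ?Q "\<lambda>_. r + 1" "\<lambda>p. p"] by (simp add: Suc_le_eq)
  also have "\<dots> \<le> (\<Prod>p\<in>prime_factors (nat \<bar>z\<bar>). p)"
    using sub by (intro dvd_imp_le prod_dvd_prod_subset) (auto intro!: prod_pos prime_gt_0_nat)
  also have "\<dots> \<le> (\<Prod>p\<in>prime_factors (nat \<bar>z\<bar>). p ^ multiplicity p (nat \<bar>z\<bar>))"
    by (intro prod_mono) (auto intro!: self_le_power prime_ge_1_nat simp: prime_factors_multiplicity)
  also have "\<dots> = nat \<bar>z\<bar>" using nz by (simp add: prime_factorization_nat[symmetric])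
  finally have le: "(r + 1) ^ card ?Q \<le> nat \<bar>z\<bar>" .
  show "card ?Q \<le> K"
  proof (rule ccontr)
    assume "\<not> card ?Q \<le> K"
    then have K: "K < card ?Q" by simp
    have "r ^ K < (r + 1) ^ card ?Q"
    proof -
      have "r ^ K \<le> r ^ card ?Q" using K r by (intro power_increasing) auto
      also have "\<dots> < (r + 1) ^ card ?Q" using K by (intro power_strict_mono) auto
      finally show ?thesis .
    qed
    moreover have "nat \<bar>z\<bar> \<le> r ^ K" using z(2) by (simp add: nat_le_iff)
    ultimately show False using le by linarith
  qed
qed

text \<open>
  Primes up to \<open>r\<close> give the term \<open>4 / n\<close>. For primes beyond \<open>r\<close>, either \<open>a * x + b = 0\<close>, which
  determines \<open>x\<close>, or at most \<open>K\<close> primes divide \<open>a * x + b\<close>, and each of them leaves at most three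
  values of \<open>y\<close>. In all, the large primes account for at most \<open>(3 * K + 1) * (2 * r + 1)\<close> pairs.
\<close>
lemma card_common_prime_divisor_le:
  fixes a b c :: int
  assumes n: "n > 0" and r: "r > 0"
    and bound: "\<And>x. \<bar>x\<bar> \<le> int r \<Longrightarrow> \<bar>a * x + b\<bar> \<le> int r ^ K"
  shows "real (card {(x, y) \<in> {- int r..int r} \<times> {- int r..int r}.
      \<exists>p. prime p \<and> n < p \<and> \<not> int p dvd a \<and> int p dvd a * x + b \<and> int p dvd a * y + c})
    \<le> (4 / real n + real (3 * K + 1) / (2 * real r + 1)) * (2 * real r + 1)\<^sup>2"
proof -
  let ?R = "{- int r..int r}"
  have cop: "coprime (int p) a" if "prime p" "\<not> int p dvd a" for p
    using that by (intro prime_imp_coprime) auto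
  define B where "B = {(x, y) \<in> ?R \<times> ?R.
    \<exists>p. prime p \<and> n < p \<and> \<not> int p dvd a \<and> int p dvd a * x + b \<and> int p dvd a * y + c}"
  define S where "S = {(x, y) \<in> ?R \<times> ?R.
    \<exists>d\<in>{n<..r}. coprime (int d) a \<and> int d dvd a * x + b \<and> int d dvd a * y + c}"
  define Z where "Z = {x \<in> ?R. a \<noteq> 0 \<and> a * x + b = 0} \<times> ?R"
  define Q where "Q x = {p. prime p \<and> r < p \<and> int p dvd a * x + b}" for x
  define Y where "Y p = {y \<in> ?R. int p dvd a * y + c}" for p
  define W where "W = {x \<in> ?R. a * x + b \<noteq> 0}"
  define D where "D x = {p \<in> Q x. \<not> int p dvd a}" for x
  have W: "finite (Q x)" "card (Q x) \<le> K" if "x \<in> W" for x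
    using card_large_prime_divisors_le[of "a * x + b" r K] bound[of x] that r
    unfolding Q_def W_def by (auto simp: abs_le_iff)
  have D: "finite (D x)" "card (D x) \<le> K" if "x \<in> W" for x
  proof -
    show "finite (D x)" using W(1)[OF that] unfolding D_def by simp
    have "card (D x) \<le> card (Q x)" using W(1)[OF that] unfolding D_def by (intro card_mono) auto
    then show "card (D x) \<le> K" using W(2)[OF that] by simp
  qed
  have Y: "card (Y p) \<le> 3" if "p \<in> D x" for p x
  proof -
    have p: "prime p" "r < p" "\<not> int p dvd a" using that unfolding D_def Q_def by auto
    have "real (card (Y p)) \<le> (2 * real r + 1) / real p + 1"
      unfolding Y_def using p prime_gt_0_nat by (intro card_linear_congruence_le cop) auto
    also have "\<dots> < 3" using p by (simp add: field_simps)
    finally show ?thesis by simp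
  qed
  have finY: "finite (Y p)" for p unfolding Y_def by auto
  have finD: "finite (\<Union>p\<in>D x. Y p)" if "x \<in> W" for x using D(1)[OF that] finY by auto
  have "B \<subseteq> S \<union> Z \<union> (SIGMA x:W. \<Union>p\<in>D x. Y p)"
  proof
    fix z assume "z \<in> B"
    then obtain x y p where z: "z = (x, y)" and xy: "x \<in> ?R" "y \<in> ?R" and
      p: "prime p" "n < p" "\<not> int p dvd a" "int p dvd a * x + b" "int p dvd a * y + c"
      by (auto simp: B_def)
    have a0: "a \<noteq> 0" using p(3) by auto
    consider "p \<le> r" | "a * x + b = 0" | "p > r" "a * x + b \<noteq> 0" by linarith
    then show "z \<in> S \<union> Z \<union> (SIGMA x:W. \<Union>p\<in>D x. Y p)"
    proof cases
      case 1
      then have "z \<in> S" unfolding S_def z using p xy cop[OF p(1,3)] by auto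
      then show ?thesis by simp
    next
      case 2
      then show ?thesis using xy a0 unfolding Z_def z by simp
    next
      case 3
      then have "x \<in> W" "p \<in> D x" "y \<in> Y p" using p xy unfolding W_def D_def Q_def Y_def by auto
      then show ?thesis unfolding z by blast
    qed
  qed
  moreover have finS: "finite S" unfolding S_def by (rule finite_subset[of _ "?R \<times> ?R"]) auto
  moreover have finZ: "finite Z" unfolding Z_def by simp
  moreover have finW: "finite W" unfolding W_def by simp
  ultimately have "card B \<le> card (S \<union> Z \<union> (SIGMA x:W. \<Union>p\<in>D x. Y p))"
    using finD by (intro card_mono finite_UnI finite_SigmaI) auto
  also have "\<dots> \<le> card S + card Z + card (SIGMA x:W. \<Union>p\<in>D x. Y p)"
    using card_Un_le[of "S \<union> Z"] card_Un_le[of S Z] by (meson add_right_mono order_trans)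
  finally have B: "card B \<le> card S + card Z + card (SIGMA x:W. \<Union>p\<in>D x. Y p)" .
  have cardR: "card ?R = 2 * r + 1" by simp
  have Z: "card Z \<le> 2 * r + 1"
  proof -
    have "card {x \<in> ?R. a \<noteq> 0 \<and> a * x + b = 0} \<le> 1"
    proof (cases "a = 0")
      case False
      have "x = y" if "a * x + b = 0" "a * y + b = 0" for x y
      proof -
        have "a * x = a * y" using that by linarith
        then show ?thesis using False by simp
      qed
      then show ?thesis by (auto simp: card_le_Suc0_iff_eq)
    qed simp
    then have "card {x \<in> ?R. a \<noteq> 0 \<and> a * x + b = 0} * (2 * r + 1) \<le> 1 * (2 * r + 1)"
      by (rule mult_le_mono1)
    then show ?thesis unfolding Z_def card_cartesian_product cardR by simp
  qed
  have "card (SIGMA x:W. \<Union>p\<in>D x. Y p) = (\<Sum>x\<in>W. card (\<Union>p\<in>D x. Y p))"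
    using finD by (intro card_SigmaI[OF finW]) blast
  also have "\<dots> \<le> (\<Sum>x\<in>W. 3 * K)"
  proof (rule sum_mono)
    fix x assume x: "x \<in> W"
    have "card (\<Union>p\<in>D x. Y p) \<le> (\<Sum>p\<in>D x. card (Y p))" by (rule card_UN_le[OF D(1)[OF x]])
    also have "\<dots> \<le> (\<Sum>p\<in>D x. 3)" using Y by (intro sum_mono) auto
    also have "\<dots> \<le> 3 * K" using D(2)[OF x] by simp
    finally show "card (\<Union>p\<in>D x. Y p) \<le> 3 * K" .
  qed
  also have "\<dots> = card W * (3 * K)" by simp
  also have "\<dots> \<le> (2 * r + 1) * (3 * K)"
  proof (rule mult_le_mono1)
    have "card W \<le> card ?R" unfolding W_def by (intro card_mono) auto
    then show "card W \<le> 2 * r + 1" unfolding cardR .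
  qed
  finally have "card B \<le> card S + (3 * K + 1) * (2 * r + 1)" using B Z by (simp add: algebra_simps)
  then have "real (card B) \<le> real (card S + (3 * K + 1) * (2 * r + 1))" by (simp only: of_nat_le_iff)
  also have "\<dots> = real (card S) + real (3 * K + 1) * (2 * real r + 1)"
    by (simp add: algebra_simps)
  also have "\<dots> \<le> 4 / real n * (2 * real r + 1)\<^sup>2 + real (3 * K + 1) * (2 * real r + 1)"
    using card_common_divisor_le_radius[OF n, of r a b c] unfolding S_def by simp
  also have "\<dots> = (4 / real n + real (3 * K + 1) / (2 * real r + 1)) * (2 * real r + 1)\<^sup>2"
    by (simp add: field_simps power2_eq_square)
  finally show ?thesis unfolding B_def .
qed

section \<open>The solvable single equations have a density\<close>

text \<open>
  Bezout's identity, in a form that yields coefficients for a linear combination of integers and,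
  later, a right inverse of a matrix.
\<close>
lemma Gcd_mem_ideal:
  fixes I :: "int set"
  assumes C: "finite C" "C \<subseteq> I" and zero: "0 \<in> I"
    and add: "\<And>x y. x \<in> I \<Longrightarrow> y \<in> I \<Longrightarrow> x + y \<in> I"
    and mult: "\<And>x c. x \<in> I \<Longrightarrow> c * x \<in> I"
  shows "Gcd C \<in> I"
  using C
proof (induction C rule: finite_induct)
  case empty
  then show ?case using zero by simp
next
  case (insert a C)
  obtain u v where "u * a + v * Gcd C = gcd a (Gcd C)" using bezout_int by blast
  moreover have "u * a + v * Gcd C \<in> I" using insert by (intro add mult) auto
  ultimately show ?case by simp
qed

lemma SAT_single_iff:
  "vec (k + m) f \<in> SAT_single m k \<longleftrightarrow> (\<forall>i<m. Gcd (f ` {..<k}) dvd f (k + i))"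
proof
  assume "vec (k + m) f \<in> SAT_single m k"
  then obtain c b x where eq: "vec (k + m) f = c @\<^sub>v b" and c: "c \<in> carrier_vec k" and b: "b \<in> carrier_vec m"
    and x: "\<And>j. j < k \<Longrightarrow> x j \<in> carrier_vec m"
    and sum: "finsum_vec TYPE(int) m (\<lambda>j. c $ j \<cdot>\<^sub>v x j) {..<k} = b"
    unfolding SAT_single_def by blast
  have cj: "c $ j = f j" if "j < k" for j
    using arg_cong[OF eq, of "\<lambda>v. v $ j"] that c b by simp
  show "\<forall>i<m. Gcd (f ` {..<k}) dvd f (k + i)"
  proof (intro allI impI)
    fix i assume i: "i < m"
    have "f (k + i) = b $ i" using arg_cong[OF eq, of "\<lambda>v. v $ (k + i)"] i c b by simp
    also have "\<dots> = (\<Sum>j<k. (c $ j \<cdot>\<^sub>v x j) $ i)"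
      unfolding sum[symmetric] using i x by (intro index_finsum_vec) auto
    also have "\<dots> = (\<Sum>j<k. f j * x j $ i)"
    proof (intro sum.cong refl)
      fix j assume "j \<in> {..<k}"
      then show "(c $ j \<cdot>\<^sub>v x j) $ i = f j * x j $ i" using x[of j] cj[of j] i by (simp add: carrier_vecD)
    qed
    also have "Gcd (f ` {..<k}) dvd \<dots>" by (intro dvd_sum dvd_mult2 Gcd_dvd) auto
    finally show "Gcd (f ` {..<k}) dvd f (k + i)" .
  qed
next
  assume dvd: "\<forall>i<m. Gcd (f ` {..<k}) dvd f (k + i)"
  let ?g = "Gcd (f ` {..<k})"
  have "?g \<in> range (\<lambda>u. \<Sum>j<k. u j * f j)"
  proof (rule Gcd_mem_ideal)
    show "f ` {..<k} \<subseteq> range (\<lambda>u. \<Sum>j<k. u j * f j)"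
    proof
      fix z assume "z \<in> f ` {..<k}"
      then obtain j where j: "j < k" "z = f j" by auto
      have "(\<Sum>i<k. (if i = j then 1 else 0) * f i) = (\<Sum>i<k. if i = j then f j else 0)"
        by (intro sum.cong) auto
      then have "z = (\<Sum>i<k. (if i = j then 1 else 0) * f i)" using j by simp
      then show "z \<in> range (\<lambda>u. \<Sum>j<k. u j * f j)"
        using rangeI[of "\<lambda>u. \<Sum>j<k. u j * f j" "\<lambda>i. if i = j then 1 else 0"] by (simp only:)
    qed
    show "0 \<in> range (\<lambda>u. \<Sum>j<k. u j * f j)" by (rule range_eqI[of _ _ "\<lambda>_. 0"]) simp
  next
    fix x y assume "x \<in> range (\<lambda>u. \<Sum>j<k. u j * f j)" "y \<in> range (\<lambda>u. \<Sum>j<k. u j * f j)"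
    then obtain u v where "x = (\<Sum>j<k. u j * f j)" "y = (\<Sum>j<k. v j * f j)" by auto
    then show "x + y \<in> range (\<lambda>u. \<Sum>j<k. u j * f j)"
      by (intro range_eqI[of _ _ "\<lambda>j. u j + v j"]) (simp add: sum.distrib distrib_right)
  next
    fix x c assume "x \<in> range (\<lambda>u. \<Sum>j<k. u j * f j)"
    then obtain u where "x = (\<Sum>j<k. u j * f j)" by auto
    then show "c * x \<in> range (\<lambda>u. \<Sum>j<k. u j * f j)"
      by (intro range_eqI[of _ _ "\<lambda>j. c * u j"]) (simp add: sum_distrib_left mult.assoc)
  qed simp
  then obtain u where u: "?g = (\<Sum>j<k. u j * f j)" by auto
  define x where "x j = vec m (\<lambda>i. u j * (f (k + i) div ?g))" for j
  have "finsum_vec TYPE(int) m (\<lambda>j. vec k f $ j \<cdot>\<^sub>v x j) {..<k} = vec m (\<lambda>i. f (k + i))"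
  proof (rule eq_vecI)
    have closed: "finsum_vec TYPE(int) m (\<lambda>j. vec k f $ j \<cdot>\<^sub>v x j) {..<k} \<in> carrier_vec m"
      by (intro finsum_vec_closed) (auto simp: x_def)
    then show "dim_vec (finsum_vec TYPE(int) m (\<lambda>j. vec k f $ j \<cdot>\<^sub>v x j) {..<k}) = dim_vec (vec m (\<lambda>i. f (k + i)))"
      by (simp add: carrier_vecD)
    fix i assume "i < dim_vec (vec m (\<lambda>i. f (k + i)))"
    then have i: "i < m" by simp
    have "finsum_vec TYPE(int) m (\<lambda>j. vec k f $ j \<cdot>\<^sub>v x j) {..<k} $ i = (\<Sum>j<k. (vec k f $ j \<cdot>\<^sub>v x j) $ i)"
      using i by (intro index_finsum_vec) (auto simp: x_def)
    also have "\<dots> = (\<Sum>j<k. u j * f j * (f (k + i) div ?g))"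
      using i by (intro sum.cong) (auto simp: x_def)
    also have "\<dots> = ?g * (f (k + i) div ?g)" unfolding u sum_distrib_right ..
    also have "\<dots> = f (k + i)" using dvd i by simp
    finally show "finsum_vec TYPE(int) m (\<lambda>j. vec k f $ j \<cdot>\<^sub>v x j) {..<k} $ i = vec m (\<lambda>i. f (k + i)) $ i"
      using i by simp
  qed
  moreover have "vec (k + m) f = vec k f @\<^sub>v vec m (\<lambda>i. f (k + i))"
    by (rule eq_vecI) auto
  ultimately show "vec (k + m) f \<in> SAT_single m k"
    unfolding SAT_single_def mem_Collect_eq
    by (intro exI[of _ "vec k f"] exI[of _ "vec m (\<lambda>i. f (k + i))"] conjI exI[of _ x])
      (simp_all add: x_def)
qed

text \<open>
  Let \<open>g\<close> be the gcd of the coefficients. The approximating set requires only that the gcd of \<open>g\<close>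
  and \<open>q = n!\<close> divides the right-hand side. If an equation in it is not solvable, then \<open>g\<close> does not
  divide \<open>n!\<close>, so it is either zero or larger than \<open>n\<close>. In particular the first two coefficients,
  which exist as \<open>k \<ge> 2\<close>, vanish or have a common divisor in the interval from \<open>n + 1\<close> to \<open>r\<close>.
\<close>
lemma SAT_single_density_convergent:
  assumes k: "k \<ge> 2"
  shows "convergent (ball_density (k + m) (SAT_single m k))"
proof (rule density_convergent_if_approximable_above)
  show N: "k + m > 0" using k by simp
  fix e :: real assume e: "e > 0"
  \<comment> \<open>The divisors up to \<open>r\<close> contribute \<open>4 / n\<close>, which becomes at most \<open>e / 2\<close>.\<close>
  obtain n where n: "real n > 8 / e" using reals_Archimedean2 by blast
  have n0: "n > 0" using n e by (cases n) (auto simp: field_simps)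
  define q :: int where "q = fact n"
  have q: "q > 0" by (simp add: q_def)
  define g where "g f = Gcd (f ` {..<k})" for f :: "nat \<Rightarrow> int"
  define P where "P = {vec (k + m) f | f. \<forall>i<m. gcd (g f) q dvd f (k + i)}"
  \<comment> \<open>Applied in both directions, this shows that \<open>gcd (g f) q\<close> depends on \<open>f\<close> modulo \<open>q\<close> only.\<close>
  have cong: "gcd (g f) q dvd gcd (g f') q"
    if "\<And>j. j < k + m \<Longrightarrow> f j mod q = f' j mod q" for f f'
  proof -
    have "gcd (g f) q dvd f' j" if "j < k" for j
    proof -
      have "q dvd f j - f' j" using that \<open>\<And>j. j < k + m \<Longrightarrow> f j mod q = f' j mod q\<close> by (simp add: mod_eq_dvd_iff)
      then have "gcd (g f) q dvd f j - f' j" by (rule dvd_trans[OF gcd_dvd2])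
      moreover have "gcd (g f) q dvd f j" 
        using that unfolding g_def by (intro dvd_trans[OF gcd_dvd1 Gcd_dvd]) auto
      ultimately show ?thesis using dvd_diff[of "gcd (g f) q" "f j" "f j - f' j"] by simp
    qed
    then show ?thesis unfolding g_def[of f'] by (intro gcd_greatest Gcd_greatest) auto
  qed
  have P_iff: "vec (k + m) f \<in> P \<longleftrightarrow> (\<forall>i<m. gcd (g f) q dvd f (k + i))" for f
  proof
    assume "vec (k + m) f \<in> P"
    then obtain f' where f': "vec (k + m) f = vec (k + m) f'" "\<forall>i<m. gcd (g f') q dvd f' (k + i)"
      unfolding P_def by auto
    have "f j = f' j" if "j < k + m" for j using arg_cong[OF f'(1), of "\<lambda>v. v $ j"] that by simp
    moreover from this have "g f = g f'" unfolding g_def by (intro arg_cong[of _ _ Gcd] image_cong) auto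
    ultimately show "\<forall>i<m. gcd (g f) q dvd f (k + i)" using f'(2) by simp
  qed (auto simp: P_def)
  have "convergent (ball_density (k + m) P)"
  proof (rule periodic_density_convergent[OF N q])
    fix f f' assume eq: "\<And>i. i < k + m \<Longrightarrow> f i mod q = f' i mod q" and "vec (k + m) f \<in> P"
    then have f: "\<forall>i<m. gcd (g f) q dvd f (k + i)" by (simp add: P_iff)
    have "gcd (g f') q dvd f' (k + i)" if "i < m" for i
    proof -
      have "q dvd f (k + i) - f' (k + i)" using eq[of "k + i"] that by (simp add: mod_eq_dvd_iff)
      then have "gcd (g f') q dvd f (k + i) - f' (k + i)" by (rule dvd_trans[OF gcd_dvd2])
      moreover have "gcd (g f') q dvd f (k + i)" 
      proof (rule dvd_trans)
        show "gcd (g f') q dvd gcd (g f) q" by (rule cong) (simp add: eq)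
        show "gcd (g f) q dvd f (k + i)" using f that by simp
      qed
      ultimately show ?thesis
        using dvd_diff[of "gcd (g f') q" "f (k + i)" "f (k + i) - f' (k + i)"] by simp
    qed
    then show "vec (k + m) f' \<in> P" by (simp add: P_iff)
  qed
  moreover have "SAT_single m k \<subseteq> P"
  proof
    fix v assume v: "v \<in> SAT_single m k"
    then have "v \<in> carrier_vec (k + m)" unfolding SAT_single_def by auto
    then have eq: "vec (k + m) (\<lambda>i. v $ i) = v" by auto
    then have "\<forall>i<m. g (\<lambda>i. v $ i) dvd v $ (k + i)"
      using v SAT_single_iff[of k m "\<lambda>i. v $ i"] unfolding g_def by simp
    then have "\<forall>i<m. gcd (g (\<lambda>i. v $ i)) q dvd v $ (k + i)" by (meson dvd_trans gcd_dvd1)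
    then show "v \<in> P" using P_iff[of "\<lambda>i. v $ i"] eq by simp
  qed
  moreover have "ball_density (k + m) (P - SAT_single m k) r \<le> 4 / real n + 1 / (2 * real r + 1)\<^sup>2" for r
  proof (rule density_le_if_slices_le[OF N, of 0 1])
    fix f :: "nat \<Rightarrow> int"
    let ?R = "{- int r..int r}"
    let ?S = "{(x, y) \<in> ?R \<times> ?R.
      \<exists>d\<in>{n<..r}. coprime (int d) 1 \<and> int d dvd 1 * x + 0 \<and> int d dvd 1 * y + 0}"
    let ?L = "{(x, y) \<in> ?R \<times> ?R. vec (k + m) (f(0 := x, 1 := y)) \<in> P - SAT_single m k}"
    have "?L \<subseteq> insert (0, 0) ?S"
    proof
      fix z assume "z \<in> ?L"
      then obtain x y where z: "z = (x, y)" and xy: "x \<in> ?R" "y \<in> ?R"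
        and "vec (k + m) (f(0 := x, 1 := y)) \<in> P - SAT_single m k" by auto
      then obtain F where L: "vec (k + m) F \<in> P - SAT_single m k" and F: "F 0 = x" "F 1 = y"
        by (metis fun_upd_apply zero_neq_one)
      define h where "h = g F"
      have "\<not> h dvd q"
      proof
        assume "h dvd q"
        then have "gcd h q = h" unfolding h_def g_def by (simp add: gcd_proj1_iff)
        moreover have "\<forall>i<m. gcd h q dvd F (k + i)" using L P_iff[of F] by (simp add: h_def)
        moreover have "\<not> (\<forall>i<m. h dvd F (k + i))" using L SAT_single_iff[of k m F] by (simp add: h_def g_def)
        ultimately show False by simp
      qed
      have h0: "h \<ge> 0" by (simp add: h_def g_def)
      have "h dvd x" unfolding h_def g_def using k F by (intro Gcd_dvd image_eqI[of _ _ 0]) auto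
      moreover have "h dvd y" unfolding h_def g_def using k F by (intro Gcd_dvd image_eqI[of _ _ 1]) auto
      moreover have "n < nat h \<and> nat h \<le> r" if "(x, y) \<noteq> (0, 0)"
      proof
        have "h \<noteq> 0" using that \<open>h dvd x\<close> \<open>h dvd y\<close> by auto
        then have "nat h > 0" using h0 by simp
        show "n < nat h"
        proof (rule ccontr)
          assume "\<not> n < nat h"
          then have "nat h dvd fact n" using \<open>nat h > 0\<close> by (intro dvd_fact) auto
          then have "int (nat h) dvd int (fact n)" by (simp only: int_dvd_int_iff)
          then show False using \<open>\<not> h dvd q\<close> h0 by (simp add: q_def)
        qed
        have "h \<le> \<bar>x\<bar> \<or> h \<le> \<bar>y\<bar>"
          using that \<open>h dvd x\<close> \<open>h dvd y\<close> by (metis dvd_imp_le_int h0 abs_of_nonneg prod.inject)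
        then show "nat h \<le> r" using xy by auto
      qed
      ultimately show "z \<in> insert (0, 0) ?S"
      proof (cases "(x, y) = (0, 0)")
        case False
        then have "nat h \<in> {n<..r}" "int (nat h) = h"
          using \<open>(x, y) \<noteq> (0, 0) \<Longrightarrow> n < nat h \<and> nat h \<le> r\<close> h0 by auto
        then have "z \<in> ?S" using xy \<open>h dvd x\<close> \<open>h dvd y\<close> unfolding z by (auto intro!: bexI[of _ "nat h"])
        then show ?thesis by simp
      qed (simp add: z)
    qed
    moreover have fin: "finite ?S" by (rule finite_subset[of _ "?R \<times> ?R"]) auto
    ultimately have "card ?L \<le> card (insert (0, 0) ?S)" by (intro card_mono) auto
    also have "\<dots> \<le> card ?S + 1" using fin by (simp add: card_insert_if)
    finally have "real (card ?L) \<le> real (card ?S) + 1" by simp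
    also have "\<dots> \<le> 4 / real n * (2 * real r + 1)\<^sup>2 + 1"
      using card_common_divisor_le_radius[OF n0, of r 1 0 0] by simp
    also have "\<dots> = (4 / real n + 1 / (2 * real r + 1)\<^sup>2) * (2 * real r + 1)\<^sup>2"
      by (simp add: field_simps)
    finally show "real (card ?L) \<le> (4 / real n + 1 / (2 * real r + 1)\<^sup>2) * (2 * real r + 1)\<^sup>2" .
  qed (use k in auto)
  moreover have "\<forall>\<^sub>F r in sequentially. 4 / real n + 1 / (2 * real r + 1)\<^sup>2 \<le> e"
  proof -
    have "(\<lambda>r. 1 / (2 * real r + 1)\<^sup>2) \<longlonglongrightarrow> 0" by real_asymp
    then have "\<forall>\<^sub>F r in sequentially. 1 / (2 * real r + 1)\<^sup>2 < e / 2"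
      using e by (intro order_tendstoD) auto
    moreover have "4 / real n \<le> e / 2" using n n0 e by (simp add: field_simps)
    ultimately show ?thesis by (auto elim!: eventually_mono)
  qed
  ultimately show "\<exists>P. SAT_single m k \<subseteq> P \<and> convergent (ball_density (k + m) P) \<and>
      (\<forall>\<^sub>F r in sequentially. ball_density (k + m) (P - SAT_single m k) r \<le> e)"
    by (intro exI[of _ P]) (auto elim!: eventually_mono intro: order_trans)
qed

section \<open>Maximal minors\<close>

text \<open>
  The minor of the first \<open>i\<close> rows and the columns \<open>s 0, \<dots>, s (i - 1)\<close>. The columns are given by an
  arbitrary function instead of a set, so that a further column can be put into the last position
  without reordering and no sign appears in the expansion along the last row.
\<close>
definition leading_minor :: "(nat \<Rightarrow> nat \<Rightarrow> int) \<Rightarrow> (nat \<Rightarrow> nat) \<Rightarrow> nat \<Rightarrow> int" where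
  "leading_minor a s i = det (mat i i (\<lambda>(p, q). a p (s q)))"

lemma abs_det_le:
  fixes A :: "int mat"
  assumes A: "A \<in> carrier_mat n n" and le: "\<And>p q. p < n \<Longrightarrow> q < n \<Longrightarrow> \<bar>A $$ (p, q)\<bar> \<le> c"
  shows "\<bar>det A\<bar> \<le> fact n * c ^ n"
proof -
  have "\<bar>det A\<bar> \<le> (\<Sum>p \<in> {p. p permutes {0..<n}}. \<bar>signof p * (\<Prod>i = 0..<n. A $$ (i, p i))\<bar>)"
    unfolding det_def'[OF A] by (rule sum_abs)
  also have "\<dots> \<le> (\<Sum>p \<in> {p. p permutes {0..<n}}. c ^ n)"
  proof (rule sum_mono)
    fix p assume "p \<in> {p. p permutes {0..<n}}"
    then have p: "p permutes {0..<n}" by simp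
    have "\<bar>signof p * (\<Prod>i = 0..<n. A $$ (i, p i))\<bar> = (\<Prod>i = 0..<n. \<bar>A $$ (i, p i)\<bar>)"
      by (simp add: abs_mult abs_prod sign_def)
    also have "\<dots> \<le> (\<Prod>i = 0..<n. c)"
      using permutes_in_image[OF p] le by (intro prod_mono) auto
    finally show "\<bar>signof p * (\<Prod>i = 0..<n. A $$ (i, p i))\<bar> \<le> c ^ n" by simp
  qed
  also have "\<dots> = fact n * c ^ n" by (simp add: card_permutations)
  finally show ?thesis .
qed

lemma abs_leading_minor_le:
  assumes "\<And>p q. p < i \<Longrightarrow> q < i \<Longrightarrow> \<bar>a p (s q)\<bar> \<le> c"
  shows "\<bar>leading_minor a s i\<bar> \<le> fact i * c ^ i"
  unfolding leading_minor_def using assms by (intro abs_det_le) auto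

lemma det_cong_mod:
  fixes A B :: "int mat"
  assumes A: "A \<in> carrier_mat n n" and B: "B \<in> carrier_mat n n"
    and cong: "\<And>p q. p < n \<Longrightarrow> q < n \<Longrightarrow> [A $$ (p, q) = B $$ (p, q)] (mod m)"
  shows "[det A = det B] (mod m)"
  unfolding det_def'[OF A] det_def'[OF B]
proof (intro cong_sum cong_scalar_left cong_prod)
  fix p i assume "p \<in> {p. p permutes {0..<n}}" "i \<in> {0..<n}"
  then show "[A $$ (i, p i) = B $$ (i, p i)] (mod m)"
    using permutes_in_image[of p "{0..<n}" i] by (intro cong) auto
qed

lemma leading_minor_cong_mod:
  assumes "\<And>p q. p < i \<Longrightarrow> q < i \<Longrightarrow> [a p (s q) = b p (s q)] (mod m)"
  shows "[leading_minor a s i = leading_minor b s i] (mod m)"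
  unfolding leading_minor_def using assms by (intro det_cong_mod) auto

lemma leading_minor_cong:
  assumes "\<And>p q. p < i \<Longrightarrow> q < i \<Longrightarrow> a p (s q) = b p (t q)"
  shows "leading_minor a s i = leading_minor b t i"
proof -
  have "mat i i (\<lambda>(p, q). a p (s q)) = mat i i (\<lambda>(p, q). b p (t q))"
    by (rule eq_matI) (auto simp: assms)
  then show ?thesis unfolding leading_minor_def by simp
qed

text \<open>
  The expansion along row \<open>i\<close> of the minor with the rows up to \<open>i\<close> and the columns \<open>s\<close> and \<open>j\<close>,
  without the corner term. It involves the entries of row \<open>i\<close> in the columns \<open>s\<close> only.
\<close>
definition border_remainder :: "(nat \<Rightarrow> nat \<Rightarrow> int) \<Rightarrow> (nat \<Rightarrow> nat) \<Rightarrow> nat \<Rightarrow> nat \<Rightarrow> int" where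
  "border_remainder a s i j =
     (\<Sum>q<i. a i (s q) * cofactor (mat (Suc i) (Suc i) (\<lambda>(p, q). a p ((s(i := j)) q))) i q)"

lemma mat_delete_last_row_cong:
  assumes M: "M \<in> carrier_mat (Suc i) (Suc i)" and M': "M' \<in> carrier_mat (Suc i) (Suc i)"
    and eq: "\<And>p q. p < i \<Longrightarrow> q < Suc i \<Longrightarrow> M $$ (p, q) = M' $$ (p, q)"
  shows "mat_delete M i j = mat_delete M' i j"
  unfolding mat_delete_def using M M' by (intro eq_matI) (auto simp: eq)

text \<open>
  The minor as a linear form in its corner entry. The matrices \<open>a\<close> and \<open>b\<close> may differ in row \<open>i\<close>
  outside the columns \<open>s\<close>, so both coefficients stay the same when such entries are varied.
\<close>
lemma leading_minor_border:
  assumes upper: "\<And>p q. p < i \<Longrightarrow> q \<in> insert j (s ` {..<i}) \<Longrightarrow> b p q = a p q"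
    and last: "\<And>q. q < i \<Longrightarrow> b i (s q) = a i (s q)"
  shows "leading_minor b (s(i := j)) (Suc i) = leading_minor a s i * b i j + border_remainder a s i j"
proof -
  let ?M = "\<lambda>a. mat (Suc i) (Suc i) (\<lambda>(p, q). a p ((s(i := j)) q)) :: int mat"
  have entry: "?M b $$ (p, q) = ?M a $$ (p, q)" if "p < i" "q < Suc i" for p q
  proof -
    have "(s(i := j)) q \<in> insert j (s ` {..<i})" using that by auto
    then have "b p ((s(i := j)) q) = a p ((s(i := j)) q)" using that by (intro upper) auto
    then show ?thesis using that by simp
  qed
  have cof: "cofactor (?M b) i q = cofactor (?M a) i q" for q
  proof -
    have "mat_delete (?M b) i q = mat_delete (?M a) i q"
      using entry by (intro mat_delete_last_row_cong) auto
    then show ?thesis unfolding cofactor_def by simp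
  qed
  have corner: "cofactor (?M a) i i = leading_minor a s i"
  proof -
    have "mat_delete (?M a) i i = mat i i (\<lambda>(p, q). a p (s q))"
      unfolding mat_delete_def by (rule eq_matI) auto
    then show ?thesis unfolding cofactor_def leading_minor_def by simp
  qed
  have "leading_minor b (s(i := j)) (Suc i) = (\<Sum>q<Suc i. ?M b $$ (i, q) * cofactor (?M b) i q)"
    unfolding leading_minor_def by (rule laplace_expansion_row) auto
  also have "\<dots> = (\<Sum>q<i. ?M b $$ (i, q) * cofactor (?M b) i q) + b i j * leading_minor a s i"
    unfolding sum.lessThan_Suc cof corner by simp
  also have "(\<Sum>q<i. ?M b $$ (i, q) * cofactor (?M b) i q) = border_remainder a s i j"
    unfolding border_remainder_def cof by (intro sum.cong) (auto simp: last)
  finally show ?thesis by (simp only: mult.commute add.commute)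
qed

lemma submatrix_columns:
  assumes A: "A \<in> carrier_mat n k" and J: "J \<subseteq> {..<k}" "card J = n"
  shows "submatrix A UNIV J = mat n n (\<lambda>(p, q). A $$ (p, pick J q))"
proof -
  have "{j. j < k \<and> j \<in> J} = J" using J by auto
  then show ?thesis using A J(2) unfolding submatrix_def by (simp add: pick_UNIV)
qed

lemma pick_mem:
  assumes J: "J \<subseteq> {..<k}" and q: "q < card J"
  shows "pick J q \<in> J" "pick J q < k"
proof -
  show "pick J q \<in> J" using q by (rule pick_in_set_le)
  then show "pick J q < k" using J by auto
qed

lemma maximal_minors_eq:
  assumes "A \<in> carrier_mat n k"
  shows "maximal_minors A
    = {leading_minor (\<lambda>p q. A $$ (p, q)) (pick J) n | J. J \<subseteq> {..<k} \<and> card J = n}"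
proof -
  have dims: "dim_row A = n" "dim_col A = k" using assms by auto
  have "det (submatrix A UNIV J) = leading_minor (\<lambda>p q. A $$ (p, q)) (pick J) n"
    if "J \<subseteq> {..<k}" "card J = n" for J
    unfolding submatrix_columns[OF assms that] leading_minor_def ..
  then show ?thesis unfolding maximal_minors_def dims
    by (intro Collect_cong iff_exI) metis
qed

lemma finite_maximal_minors: "finite (maximal_minors A)"
proof -
  have "maximal_minors A \<subseteq> (\<lambda>J. det (submatrix A UNIV J)) ` Pow {..<dim_col A}"
    unfolding maximal_minors_def by auto
  then show ?thesis by (rule finite_subset) auto
qed

text \<open>
  A minor with a repeated column is zero, and any other one is, up to sign, the maximal minor with
  the same set of columns.
\<close>
lemma dvd_leading_minor_if_dvd_maximal_minors:
  assumes A: "A \<in> carrier_mat n k" and dvd: "\<And>z. z \<in> maximal_minors A \<Longrightarrow> d dvd z"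
    and s: "s ` {..<n} \<subseteq> {..<k}"
  shows "d dvd leading_minor (\<lambda>p q. A $$ (p, q)) s n"
proof (cases "inj_on s {..<n}")
  case False
  then obtain q q' where q: "q < n" "q' < n" "q \<noteq> q'" "s q = s q'" unfolding inj_on_def by auto
  have "leading_minor (\<lambda>p q. A $$ (p, q)) s n = 0"
    unfolding leading_minor_def using q
    by (intro det_identical_columns[of _ n q q']) (auto intro!: eq_vecI)
  then show ?thesis by simp
next
  case True
  define J where "J = s ` {..<n}"
  have J: "J \<subseteq> {..<k}" "card J = n" using s True unfolding J_def by (auto simp: card_image)
  have finJ: "finite J" unfolding J_def by simp
  have inj_pick: "inj_on (pick J) {..<n}"
  proof (rule inj_onI)
    fix x y assume "x \<in> {..<n}" "y \<in> {..<n}" "pick J x = pick J y"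
    then show "x = y" using pick_mono_le[of x J y] pick_mono_le[of y J x] J(2)
      by (metis lessThan_iff less_irrefl nat_neq_iff)
  qed
  have img: "pick J ` {..<n} = J"
    using pick_mem[OF J(1)] J(2) inj_pick finJ by (intro card_subset_eq) (auto simp: card_image)
  \<comment> \<open>The permutation that turns the increasing enumeration \<open>pick J\<close> of the columns into \<open>s\<close>.\<close>
  define t where "t q = (if q < n then the_inv_into {..<n} (pick J) (s q) else q)" for q
  have t: "pick J (t q) = s q" "t q < n" if "q < n" for q
  proof -
    have "s q \<in> pick J ` {..<n}" using that img unfolding J_def by auto
    then show "pick J (t q) = s q" "t q < n"
      using f_the_inv_into_f[OF inj_pick] the_inv_into_into[OF inj_pick _ subset_refl] that
      unfolding t_def by auto
  qed
  have "t permutes {0..<n}"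
  proof (rule bij_imp_permutes)
    have "inj_on t {0..<n}"
    proof (rule inj_onI)
      fix x y assume "x \<in> {0..<n}" "y \<in> {0..<n}" "t x = t y"
      then show "x = y" using t(1)[of x] t(1)[of y] True by (auto simp: inj_on_def)
    qed
    moreover have "t ` {0..<n} \<subseteq> {0..<n}" using t(2) by auto
    ultimately show "bij_betw t {0..<n} {0..<n}"
      by (simp add: bij_betw_def endo_inj_surj)
    show "t x = x" if "x \<notin> {0..<n}" for x using that by (simp add: t_def)
  qed
  let ?B = "mat n n (\<lambda>(p, q). A $$ (p, pick J q))"
  let ?C = "mat n n (\<lambda>(p, q). A $$ (p, s q))"
  have "transpose_mat ?C = mat n n (\<lambda>(p, q). transpose_mat ?B $$ (t p, q))"
    by (rule eq_matI) (auto simp: t)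
  then have "det ?C = signof t * det ?B"
    using det_permute_rows[of "transpose_mat ?B" n t] \<open>t permutes {0..<n}\<close>
      det_transpose[of ?B n] det_transpose[of ?C n] by simp
  moreover have "det ?B \<in> maximal_minors A"
    unfolding maximal_minors_eq[OF A] leading_minor_def using J by auto
  ultimately show ?thesis unfolding leading_minor_def using dvd by simp
qed

text \<open>
  Take \<open>i\<close> minimal such that all minors with the rows up to \<open>i\<close> are divisible by \<open>p\<close>. The minor on
  the rows above \<open>i\<close> uses at most \<open>i \<le> k - 2\<close> columns, which leaves two columns for bordering it.
\<close>
lemma first_rank_drop:
  fixes p :: int
  assumes n: "n < k" and p: "\<not> p dvd 1"
    and all: "\<And>s. s ` {..<n} \<subseteq> {..<k} \<Longrightarrow> p dvd leading_minor a s n"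
  obtains i s j1 j2 where "i < n" "s \<in> {..<i} \<rightarrow>\<^sub>E {..<k}" "j1 < k" "j2 < k" "j1 \<noteq> j2"
    "j1 \<notin> s ` {..<i}" "j2 \<notin> s ` {..<i}" "\<not> p dvd leading_minor a s i"
    "p dvd leading_minor a (s(i := j1)) (Suc i)" "p dvd leading_minor a (s(i := j2)) (Suc i)"
proof -
  define Q where "Q i \<longleftrightarrow> (\<forall>s. s ` {..<i} \<subseteq> {..<k} \<longrightarrow> p dvd leading_minor a s i)" for i
  have "\<not> Q 0" using p unfolding Q_def leading_minor_def by (simp add: exI[of _ "\<lambda>_. 0"])
  moreover have "Q n" using all unfolding Q_def by blast
  ultimately obtain i where i: "i < n" "\<not> Q i" "Q (Suc i)"
    using ex_least_nat_less[of Q n] by blast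
  then obtain s' where s': "s' ` {..<i} \<subseteq> {..<k}" "\<not> p dvd leading_minor a s' i"
    unfolding Q_def by blast
  define s where "s = restrict s' {..<i}"
  have s: "s \<in> {..<i} \<rightarrow>\<^sub>E {..<k}" using s' unfolding s_def by auto
  have "leading_minor a s i = leading_minor a s' i" by (rule leading_minor_cong) (simp add: s_def)
  then have nd: "\<not> p dvd leading_minor a s i" using s'(2) by simp
  have ext: "p dvd leading_minor a (s(i := j)) (Suc i)" if "j < k" for j
  proof -
    have "(s(i := j)) ` {..<Suc i} \<subseteq> {..<k}" using s that by (auto simp: less_Suc_eq PiE_iff)
    then show ?thesis using i(3) unfolding Q_def by blast
  qed
  have "card (s ` {..<i}) \<le> i" using card_image_le[of "{..<i}" s] by simp
  moreover have "card {..<k} - card (s ` {..<i}) \<le> card ({..<k} - s ` {..<i})"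
    by (rule diff_card_le_card_Diff) simp
  ultimately have "2 \<le> card ({..<k} - s ` {..<i})" using i(1) n by simp
  then obtain T where T: "T \<subseteq> {..<k} - s ` {..<i}" "card T = 2"
    by (rule obtain_subset_with_card_n)
  from T(2) obtain j1 j2 where "T = {j1, j2}" "j1 \<noteq> j2" unfolding card_2_iff by blast
  with T(1) have "{j1, j2} \<subseteq> {..<k} - s ` {..<i}" "j1 \<noteq> j2" by auto
  then show ?thesis using that[of i s j1 j2] i s nd ext by auto
qed

text \<open>
  If \<open>B\<close> is the square matrix of the columns of \<open>A\<close> in \<open>J\<close> and \<open>E\<close> is the matrix that selects these
  columns, then \<open>A * (E * adj_mat B) = B * adj_mat B = det B \<cdot> 1\<close>. So the ideal of all \<open>d\<close> such that
  \<open>d \<cdot> 1\<close> is a multiple of \<open>A\<close> contains the maximal minors and hence their gcd.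
\<close>
lemma unimodular_right_inverse:
  assumes A: "A \<in> carrier_mat n k" and gcd: "Gcd (maximal_minors A) = 1"
  obtains Y where "Y \<in> carrier_mat k n" "A * Y = 1\<^sub>m n"
proof -
  define I where "I = {d. \<exists>Y \<in> carrier_mat k n. A * Y = d \<cdot>\<^sub>m 1\<^sub>m n}"
  have "Gcd (maximal_minors A) \<in> I"
  proof (rule Gcd_mem_ideal[OF finite_maximal_minors])
    show "maximal_minors A \<subseteq> I"
    proof
      fix z assume "z \<in> maximal_minors A"
      then obtain J where J: "J \<subseteq> {..<k}" "card J = n"
        and z: "z = det (mat n n (\<lambda>(p, q). A $$ (p, pick J q)))"
        unfolding maximal_minors_eq[OF A] leading_minor_def by auto
      define B where "B = mat n n (\<lambda>(p, q). A $$ (p, pick J q))"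
      define E where "E = mat k n (\<lambda>(l, q). if l = pick J q then 1 else 0 :: int)"
      have E: "E \<in> carrier_mat k n" and B: "B \<in> carrier_mat n n" unfolding E_def B_def by auto
      have "A * E = B"
      proof (rule eq_matI)
        fix p q assume "p < dim_row B" "q < dim_col B"
        then have pq: "p < n" "q < n" unfolding B_def by auto
        have "(A * E) $$ (p, q) = (\<Sum>l = 0..<k. A $$ (p, l) * (if l = pick J q then 1 else 0))"
          using pq A E by (auto simp: scalar_prod_def E_def intro!: sum.cong)
        also have "\<dots> = (\<Sum>l = 0..<k. if l = pick J q then A $$ (p, l) else 0)"
          by (intro sum.cong) auto
        also have "\<dots> = B $$ (p, q)" using pq pick_mem(2)[OF J(1), of q] J(2) by (simp add: B_def)
        finally show "(A * E) $$ (p, q) = B $$ (p, q)" .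
      qed (use A in \<open>auto simp: E_def B_def\<close>)
      then have "A * (E * adj_mat B) = z \<cdot>\<^sub>m 1\<^sub>m n"
        using assoc_mult_mat[OF A E adj_mat(1)[OF B]] adj_mat(2)[OF B] unfolding z B_def[symmetric]
        by simp
      then show "z \<in> I" unfolding I_def using E adj_mat(1)[OF B] by auto
    qed
    show "0 \<in> I" unfolding I_def using A by (intro CollectI bexI[of _ "0\<^sub>m k n"]) auto
  next
    fix x y assume "x \<in> I" "y \<in> I"
    then obtain Y Z where "Y \<in> carrier_mat k n" "A * Y = x \<cdot>\<^sub>m 1\<^sub>m n" "Z \<in> carrier_mat k n" "A * Z = y \<cdot>\<^sub>m 1\<^sub>m n"
      unfolding I_def by auto
    then show "x + y \<in> I" unfolding I_def using A
      by (intro CollectI bexI[of _ "Y + Z"])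
        (auto simp: mult_add_distrib_mat[OF A] add_smult_distrib_right_mat[of _ n n])
  next
    fix x c assume "x \<in> I"
    then obtain Y where "Y \<in> carrier_mat k n" "A * Y = x \<cdot>\<^sub>m 1\<^sub>m n" unfolding I_def by auto
    then show "c * x \<in> I" unfolding I_def using A
      by (intro CollectI bexI[of _ "c \<cdot>\<^sub>m Y"])
        (auto simp: mult_smult_distrib[OF A])
  qed
  then obtain Y where "Y \<in> carrier_mat k n" "A * Y = 1 \<cdot>\<^sub>m 1\<^sub>m n" unfolding gcd I_def by auto
  moreover have "1 \<cdot>\<^sub>m 1\<^sub>m n = (1\<^sub>m n :: int mat)" by (rule eq_matI) auto
  ultimately show ?thesis using that by simp
qed

text \<open>
  Some maximal minor is nonzero, as otherwise the gcd would be zero. It stays nonzero over the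
  rationals and bounds the rank from below.
\<close>
lemma rank_eq_if_Gcd_maximal_minors:
  assumes A: "A \<in> carrier_mat n k" and gcd: "Gcd (maximal_minors A) = 1"
  shows "vec_space.rank n (map_mat rat_of_int A) = n"
proof -
  interpret vec_space "TYPE(rat)" n .
  let ?A = "map_mat rat_of_int A"
  have A': "?A \<in> carrier_mat n k" using A by simp
  obtain J where J: "J \<subseteq> {..<k}" "card J = n" and nz: "det (submatrix A UNIV J) \<noteq> 0"
  proof (rule ccontr)
    assume "\<not> thesis"
    then have "maximal_minors A \<subseteq> {0}" using that A unfolding maximal_minors_def by auto
    then have "Gcd (maximal_minors A) = 0" by (simp add: Gcd_0_iff)
    then show False using gcd by simp
  qed
  have "submatrix ?A UNIV J = map_mat rat_of_int (submatrix A UNIV J)"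
    unfolding submatrix_columns[OF A J] submatrix_columns[OF A' J]
    using A J pick_mem(2)[OF J(1)] by (intro eq_matI) auto
  then have "det (submatrix ?A UNIV J) \<noteq> 0" using nz by simp
  from rank_gt_minor[OF A' this] have "card {j. j < k \<and> j \<in> J} \<le> rank ?A" .
  moreover have "{j. j < k \<and> j \<in> J} = J" using J by auto
  ultimately have "n \<le> rank ?A" using J by simp
  moreover have "rank ?A \<le> n"
  proof -
    have "set (cols ?A) \<subseteq> carrier_vec n" using A' cols_dim by blast
    then have "subspace class_ring (span (set (cols ?A))) V" by (intro span_is_subspace) simp
    then show ?thesis
      unfolding rank_def using subspace_dim[OF _ fin_dim fin_dim_span_cols[OF A']] dim_is_n by simp
  qed
  ultimately show ?thesis by simp
qed

lemma unimodular_mats_eq: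
  "unimodular_mats n k = {A \<in> carrier_mat n k. Gcd (maximal_minors A) = 1}"
  unfolding unimodular_mats_def using rank_eq_if_Gcd_maximal_minors by auto

section \<open>Matrices as points of the lattice\<close>

lemma index_less_mult:
  fixes i j n k :: nat
  assumes "i < n" "j < k"
  shows "i * k + j < n * k"
proof -
  have "i * k + j < Suc i * k" using assms by simp
  also have "\<dots> \<le> n * k" using assms by (intro mult_le_mono1) simp
  finally show ?thesis .
qed

definition unflatten :: "nat \<Rightarrow> nat \<Rightarrow> int vec \<Rightarrow> int mat" where
  "unflatten n k v = mat n k (\<lambda>(i, j). v $ (i * k + j))"

lemma unflatten_carrier [simp]: "unflatten n k v \<in> carrier_mat n k"
  by (simp add: unflatten_def)

lemma unflatten_dim [simp]: "dim_row (unflatten n k v) = n" "dim_col (unflatten n k v) = k"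
  by (simp_all add: unflatten_def)

lemma unflatten_index [simp]:
  "i < n \<Longrightarrow> j < k \<Longrightarrow> unflatten n k v $$ (i, j) = v $ (i * k + j)"
  by (simp add: unflatten_def)

lemma flatten_carrier: "A \<in> carrier_mat n k \<Longrightarrow> flatten_mat A \<in> carrier_vec (n * k)"
  by (auto simp: flatten_mat_def)

lemma flatten_index:
  assumes "A \<in> carrier_mat n k" "i < n" "j < k"
  shows "flatten_mat A $ (i * k + j) = A $$ (i, j)"
  using assms index_less_mult[OF assms(2,3)] by (auto simp: flatten_mat_def)

lemma unflatten_flatten: "A \<in> carrier_mat n k \<Longrightarrow> unflatten n k (flatten_mat A) = A"
  by (rule eq_matI) (auto simp: flatten_index)

lemma flatten_unflatten:
  assumes "v \<in> carrier_vec (n * k)"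
  shows "flatten_mat (unflatten n k v) = v"
proof (rule eq_vecI)
  fix l assume "l < dim_vec v"
  then have l: "l < n * k" using assms by simp
  then have "l div k < n" "l mod k < k"
    by (auto simp: less_mult_imp_div_less) (metis gr_zeroI less_nat_zero_code mod_less_divisor mult_0_right)
  then show "flatten_mat (unflatten n k v) $ l = v $ l"
    using l by (simp add: flatten_mat_def unflatten_def)
qed (use assms in \<open>simp add: flatten_mat_def unflatten_def\<close>)

lemma U_set_iff:
  "v \<in> U_set n k \<longleftrightarrow> v \<in> carrier_vec (n * k) \<and> Gcd (maximal_minors (unflatten n k v)) = 1"
proof
  assume "v \<in> U_set n k"
  then obtain A where A: "A \<in> carrier_mat n k" "Gcd (maximal_minors A) = 1" and v: "v = flatten_mat A"
    unfolding U_set_def unimodular_mats_eq by auto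
  then show "v \<in> carrier_vec (n * k) \<and> Gcd (maximal_minors (unflatten n k v)) = 1"
    using flatten_carrier[OF A(1)] unflatten_flatten[OF A(1)] by simp
next
  assume "v \<in> carrier_vec (n * k) \<and> Gcd (maximal_minors (unflatten n k v)) = 1"
  then show "v \<in> U_set n k" unfolding U_set_def unimodular_mats_eq
    by (intro image_eqI[of _ _ "unflatten n k v"]) (auto simp: flatten_unflatten)
qed

section \<open>The unimodular matrices have a density\<close>

lemma ball_density_le_sum:
  assumes N: "N > 0" and X: "finite X" and sub: "M \<inter> int_ball N r \<subseteq> (\<Union>x\<in>X. E x)"
  shows "ball_density N M r \<le> (\<Sum>x\<in>X. ball_density N (E x) r)"
proof -
  have "M \<inter> int_ball N r \<subseteq> (\<Union>x\<in>X. E x \<inter> int_ball N r)" using sub by auto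
  then have "card (M \<inter> int_ball N r) \<le> card (\<Union>x\<in>X. E x \<inter> int_ball N r)"
    using X finite_int_ball[OF N] by (intro card_mono) auto
  also have "\<dots> \<le> (\<Sum>x\<in>X. card (E x \<inter> int_ball N r))" by (rule card_UN_le[OF X])
  finally have "real (card (M \<inter> int_ball N r)) \<le> real (\<Sum>x\<in>X. card (E x \<inter> int_ball N r))"
    by (simp only: of_nat_le_iff)
  then show ?thesis unfolding ball_density_def sum_divide_distrib[symmetric]
    by (intro divide_right_mono) auto
qed

text \<open>
  The matrices for which the conclusion of \<open>first_rank_drop\<close> holds with these indices and some
  prime beyond \<open>M\<close>.
\<close>
definition rank_drop_set :: "nat \<Rightarrow> nat \<Rightarrow> nat \<Rightarrow> nat \<times> (nat \<Rightarrow> nat) \<times> nat \<times> nat \<Rightarrow> int vec set" where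
  "rank_drop_set n k M = (\<lambda>(i, s, j1, j2). {v. \<exists>p. prime p \<and> M < p \<and>
     (let a = (\<lambda>p q. unflatten n k v $$ (p, q)) in
       \<not> int p dvd leading_minor a s i \<and>
       int p dvd leading_minor a (s(i := j1)) (Suc i) \<and>
       int p dvd leading_minor a (s(i := j2)) (Suc i))})"

text \<open>
  When only the entries of row \<open>i\<close> in the columns \<open>j1\<close> and \<open>j2\<close> vary, the two bordered minors
  are linear forms in one of these entries each, and their common leading coefficient is constant.
  The condition on \<open>r\<close> absorbs the factorial in the bound \<open>fact (i + 1) * r ^ (i + 1)\<close> for these
  minors.
\<close>
lemma rank_drop_set_density_le:
  assumes M: "M > 0" and i: "i < n" and s: "s \<in> {..<i} \<rightarrow>\<^sub>E {..<k}"
    and j: "j1 < k" "j2 < k" "j1 \<noteq> j2" "j1 \<notin> s ` {..<i}" "j2 \<notin> s ` {..<i}"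
    and r: "fact n \<le> r"
  shows "ball_density (n * k) (rank_drop_set n k M (i, s, j1, j2)) r
    \<le> 4 / real M + real (3 * (n + 1) + 1) / (2 * real r + 1)"
proof (rule density_le_if_slices_le)
  let ?l1 = "i * k + j1" and ?l2 = "i * k + j2"
  show l: "?l1 < n * k" "?l2 < n * k" "?l1 \<noteq> ?l2" using i j index_less_mult by auto
  then show "n * k > 0" by linarith
  have r0: "r > 0" using r fact_gt_zero[of n, where 'a = nat] by linarith
  fix f assume f: "f \<in> box (n * k) r"
  let ?R = "{- int r..int r}"
  define b where "b x y = (\<lambda>p q. unflatten n k (vec (n * k) (f(?l1 := x, ?l2 := y))) $$ (p, q))" for x y
  define a where "a = (\<lambda>p q. unflatten n k (vec (n * k) f) $$ (p, q))"
  have b: "b x y p q = (f(?l1 := x, ?l2 := y)) (p * k + q)" if "p < n" "q < k" for x y p q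
    using that index_less_mult[OF that] unfolding b_def by simp
  have a: "a p q = f (p * k + q)" if "p < n" "q < k" for p q
    using that index_less_mult[OF that] unfolding a_def by simp
  have sk: "s q < k" if "q < i" for q using s that by auto
  have ab: "b x y p q = a p q" if "p < i" "q < k" for x y p q
  proof -
    have "p * k + q < i * k" using that by (rule index_less_mult)
    then show ?thesis using that i b[of p q] a[of p q] by simp
  qed
  have ab': "b x y i q = a i q" if "q < k" "q \<noteq> j1" "q \<noteq> j2" for x y q
    using that i b[of i q] a[of i q] by simp
  have minor: "leading_minor (b x y) s i = leading_minor a s i" for x y
    by (rule leading_minor_cong) (auto intro: ab sk)
  have notin: "s q \<noteq> j1" "s q \<noteq> j2" if "q < i" for q using that j by auto
  have border: "leading_minor (b x y) (s(i := j)) (Suc i)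
      = leading_minor a s i * b x y i j + border_remainder a s i j" if "j < k" for x y j
    using that sk notin by (intro leading_minor_border) (auto intro: ab ab')
  have x: "b x y i j1 = x" and y: "b x y i j2 = y" for x y using b[of i] i j by auto
  let ?A = "leading_minor a s i"
  let ?B = "border_remainder a s i"
  let ?S = "{(x, y) \<in> ?R \<times> ?R. \<exists>p. prime p \<and> M < p \<and>
    \<not> int p dvd ?A \<and> int p dvd ?A * x + ?B j1 \<and> int p dvd ?A * y + ?B j2}"
  have "{(x, y) \<in> ?R \<times> ?R.
      vec (n * k) (f(?l1 := x, ?l2 := y)) \<in> rank_drop_set n k M (i, s, j1, j2)} = ?S"
    unfolding rank_drop_set_def Let_def case_prod_conv mem_Collect_eq b_def[symmetric]
      minor border[OF j(1)] border[OF j(2)] x y ..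
  moreover have "real (card ?S)
      \<le> (4 / real M + real (3 * (n + 1) + 1) / (2 * real r + 1)) * (2 * real r + 1)\<^sup>2"
  proof (rule card_common_prime_divisor_le[OF M r0])
    fix x assume x': "\<bar>x\<bar> \<le> int r"
    have fle: "\<bar>f l\<bar> \<le> int r" if "l < n * k" for l
      using f that unfolding box_def by (auto simp: PiE_iff abs_le_iff minus_le_iff)
    have "\<bar>leading_minor (b x 0) (s(i := j1)) (Suc i)\<bar> \<le> fact (Suc i) * int r ^ Suc i"
    proof (rule abs_leading_minor_le)
      fix p q assume p: "p < Suc i" and q: "q < Suc i"
      have t: "(s(i := j1)) q < k" using q sk j(1) by (cases "q = i") auto
      have p': "p < n" using p i by simp
      have "\<bar>(f(?l1 := x, ?l2 := 0)) l\<bar> \<le> int r" if "l < n * k" for l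
        using x' fle[OF that] by simp
      then show "\<bar>b x 0 p ((s(i := j1)) q)\<bar> \<le> int r"
        unfolding b[OF p' t] using index_less_mult[OF p' t] by blast
    qed
    also have "\<dots> \<le> int r * int r ^ n"
    proof (rule mult_mono)
      have "fact (Suc i) \<le> (fact n :: nat)" using i by (intro fact_mono) simp
      then have "fact (Suc i) \<le> r" using r by linarith
      then have "int (fact (Suc i)) \<le> int r" by (simp only: of_nat_le_iff)
      then show "fact (Suc i) \<le> int r" by (simp only: of_nat_fact)
      show "int r ^ Suc i \<le> int r ^ n" using i r0 by (intro power_increasing) auto
    qed auto
    finally show "\<bar>?A * x + ?B j1\<bar> \<le> int r ^ (n + 1)"
      using border[OF j(1), of x 0] x[of x 0] by simp
  qed
  ultimately show "real (card {(x, y) \<in> ?R \<times> ?R.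
      vec (n * k) (f(?l1 := x, ?l2 := y)) \<in> rank_drop_set n k M (i, s, j1, j2)})
    \<le> (4 / real M + real (3 * (n + 1) + 1) / (2 * real r + 1)) * (2 * real r + 1)\<^sup>2"
    by (simp only:)
qed

text \<open>
  The approximating set forbids only the primes up to \<open>M\<close> to divide all maximal minors. What it
  contains in excess is covered by the finitely many sets \<open>rank_drop_set\<close>, and their number does not
  depend on \<open>M\<close>.
\<close>
lemma U_density_convergent:
  assumes nk: "n < k" and n: "n > 0"
  shows "convergent (ball_density (n * k) (U_set n k))"
proof (rule density_convergent_if_approximable_above)
  show N: "n * k > 0" using nk n by simp
  fix e :: real assume e: "e > 0"
  define X where "X = {(i, s, j1, j2). i < n \<and> s \<in> {..<i} \<rightarrow>\<^sub>E {..<k} \<and> j1 < k \<and> j2 < k \<and> j1 \<noteq> j2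
    \<and> j1 \<notin> s ` {..<i} \<and> j2 \<notin> s ` {..<i}}"
  have "X \<subseteq> (SIGMA i:{..<n}. ({..<i} \<rightarrow>\<^sub>E {..<k}) \<times> {..<k} \<times> {..<k})" unfolding X_def by auto
  moreover have "finite (SIGMA i:{..<n}. ({..<i} \<rightarrow>\<^sub>E {..<k}) \<times> {..<k} \<times> {..<k})"
    by (intro finite_SigmaI finite_cartesian_product finite_PiE) auto
  ultimately have X: "finite X" by (rule finite_subset)
  \<comment> \<open>The small primes beyond \<open>M\<close> contribute \<open>4 * card X / M\<close>, which becomes at most \<open>e / 2\<close>.\<close>
  obtain M where M: "real M > 8 * real (card X) / e + 1" using reals_Archimedean2 by blast
  have "8 * real (card X) / e \<ge> 0" using e by simp
  then have M0: "M > 0" using M by (cases M) auto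
  define q :: int where "q = fact M"
  have q: "q > 0" by (simp add: q_def)
  define P where "P = {v \<in> carrier_vec (n * k). \<forall>p. prime p \<and> p \<le> M \<longrightarrow>
    (\<exists>z\<in>maximal_minors (unflatten n k v). \<not> int p dvd z)}"
  have "convergent (ball_density (n * k) P)"
  proof (rule periodic_density_convergent[OF N q])
    fix f g assume eq: "\<And>i. i < n * k \<Longrightarrow> f i mod q = g i mod q" and f: "vec (n * k) f \<in> P"
    let ?a = "\<lambda>h p q. unflatten n k (vec (n * k) h) $$ (p, q)"
    have "\<exists>z\<in>maximal_minors (unflatten n k (vec (n * k) g)). \<not> int p dvd z" if p: "prime p" "p \<le> M" for p
    proof -
      obtain J where J: "J \<subseteq> {..<k}" "card J = n" and nd: "\<not> int p dvd leading_minor (?a f) (pick J) n"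
        using f p unfolding P_def maximal_minors_eq[OF unflatten_carrier] by auto
      have "p dvd fact M" using p by (simp add: prime_dvd_fact_iff)
      then have pq: "int p dvd q" unfolding q_def by (metis of_nat_dvd_iff of_nat_fact)
      have "[leading_minor (?a f) (pick J) n = leading_minor (?a g) (pick J) n] (mod int p)"
      proof (rule leading_minor_cong_mod)
        fix i j assume ij: "i < n" "j < n"
        then have l: "pick J j < k" using pick_mem(2)[OF J(1)] J(2) by simp
        have "[f (i * k + pick J j) = g (i * k + pick J j)] (mod q)"
          using eq index_less_mult[OF ij(1) l] by (simp add: cong_def)
        then show "[?a f i (pick J j) = ?a g i (pick J j)] (mod int p)"
          using ij l index_less_mult[OF ij(1) l] pq by (auto intro: cong_dvd_modulus)
      qed
      then have "\<not> int p dvd leading_minor (?a g) (pick J) n" using nd cong_dvd_iff by blast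
      then show ?thesis using J unfolding maximal_minors_eq[OF unflatten_carrier] by blast
    qed
    then show "vec (n * k) g \<in> P" unfolding P_def by simp
  qed
  moreover have "U_set n k \<subseteq> P"
  proof
    fix v assume "v \<in> U_set n k"
    then have v: "v \<in> carrier_vec (n * k)" "Gcd (maximal_minors (unflatten n k v)) = 1"
      by (auto simp: U_set_iff)
    have "\<exists>z\<in>maximal_minors (unflatten n k v). \<not> int p dvd z" if "prime p" for p
    proof (rule ccontr)
      assume "\<not> ?thesis"
      then have "int p dvd Gcd (maximal_minors (unflatten n k v))" by (intro Gcd_greatest) auto
      then have "int p dvd 1" unfolding v(2) .
      then show False using that by (simp add: prime_nat_iff)
    qed
    then show "v \<in> P" using v(1) unfolding P_def by auto
  qed
  moreover have "\<forall>\<^sub>F r in sequentially. ball_density (n * k) (P - U_set n k) r \<le> e"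
  proof -
    let ?c = "real (card X) * real (3 * (n + 1) + 1)"
    have cover: "P - U_set n k \<subseteq> (\<Union>x\<in>X. rank_drop_set n k M x)"
    proof
      fix v assume v: "v \<in> P - U_set n k"
      let ?V = "unflatten n k v"
      have "Gcd (maximal_minors ?V) \<noteq> 1" using v by (auto simp: P_def U_set_iff)
      then have "nat (Gcd (maximal_minors ?V)) \<noteq> 1" by auto
      then obtain p where p: "prime p" "p dvd nat (Gcd (maximal_minors ?V))"
        using prime_factor_nat by blast
      have "Gcd (maximal_minors ?V) \<ge> 0" by simp
      then have "int p dvd Gcd (maximal_minors ?V)"
        using p(2) by (metis int_nat_eq of_nat_dvd_iff)
      then have dvd: "int p dvd z" if "z \<in> maximal_minors ?V" for z
        using that by (meson Gcd_dvd dvd_trans)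
      then have pM: "M < p" using v p(1) unfolding P_def by (auto simp: not_le[symmetric])
      have "\<not> int p dvd 1" using p(1) by (simp add: prime_nat_iff)
      moreover have "int p dvd leading_minor (\<lambda>p q. ?V $$ (p, q)) s n" if "s ` {..<n} \<subseteq> {..<k}" for s
        using dvd that by (rule dvd_leading_minor_if_dvd_maximal_minors[OF unflatten_carrier])
      ultimately obtain i s j1 j2 where
        idx: "i < n" "s \<in> {..<i} \<rightarrow>\<^sub>E {..<k}" "j1 < k" "j2 < k" "j1 \<noteq> j2"
          "j1 \<notin> s ` {..<i}" "j2 \<notin> s ` {..<i}" and
        minors: "\<not> int p dvd leading_minor (\<lambda>p q. ?V $$ (p, q)) s i"
          "int p dvd leading_minor (\<lambda>p q. ?V $$ (p, q)) (s(i := j1)) (Suc i)"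
          "int p dvd leading_minor (\<lambda>p q. ?V $$ (p, q)) (s(i := j2)) (Suc i)"
        by (rule first_rank_drop[OF nk])
      have "v \<in> rank_drop_set n k M (i, s, j1, j2)"
        unfolding rank_drop_set_def Let_def case_prod_conv mem_Collect_eq
        using p(1) pM minors by (intro exI[of _ p] conjI)
      moreover have "(i, s, j1, j2) \<in> X" using idx unfolding X_def by simp
      ultimately show "v \<in> (\<Union>x\<in>X. rank_drop_set n k M x)" by blast
    qed
    have dens: "ball_density (n * k) (P - U_set n k) r \<le> 4 * real (card X) / real M + ?c / (2 * real r + 1)"
      if "fact n \<le> r" for r
    proof -
      have "ball_density (n * k) (P - U_set n k) r \<le> (\<Sum>x\<in>X. ball_density (n * k) (rank_drop_set n k M x) r)"
        using cover by (intro ball_density_le_sum[OF N X]) blast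
      also have "\<dots> \<le> (\<Sum>x\<in>X. 4 / real M + real (3 * (n + 1) + 1) / (2 * real r + 1))"
        using rank_drop_set_density_le[OF M0 _ _ _ _ _ _ _ that] by (intro sum_mono) (auto simp: X_def)
      also have "\<dots> = 4 * real (card X) / real M + ?c / (2 * real r + 1)"
        by (simp add: algebra_simps add_divide_distrib)
      finally show ?thesis .
    qed
    have small: "\<forall>\<^sub>F r in sequentially. ?c / (2 * real r + 1) < e / 2"
    proof -
      have "(\<lambda>r. ?c / (2 * real r + 1)) \<longlonglongrightarrow> 0" by real_asymp
      then show ?thesis using e by (intro order_tendstoD) auto
    qed
    have half: "4 * real (card X) / real M \<le> e / 2"
    proof -
      have "8 * real (card X) / e < real M" using M by linarith
      then have "8 * real (card X) < real M * e" using e by (simp add: divide_less_eq)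
      then show ?thesis using M0 by (simp add: field_simps)
    qed
    show ?thesis using eventually_conj[OF small eventually_ge_at_top[of "fact n"]]
    proof (rule eventually_mono)
      fix r assume "?c / (2 * real r + 1) < e / 2 \<and> fact n \<le> r"
      then show "ball_density (n * k) (P - U_set n k) r \<le> e" using dens[of r] half by linarith
    qed
  qed
  ultimately show "\<exists>P. U_set n k \<subseteq> P \<and> convergent (ball_density (n * k) P) \<and>
      (\<forall>\<^sub>F r in sequentially. ball_density (n * k) (P - U_set n k) r \<le> e)"
    by blast
qed

section \<open>Comparing the densities of one box\<close>

lemma augment_carrier [simp]:
  "A \<in> carrier_mat n k \<Longrightarrow> B \<in> carrier_mat n m \<Longrightarrow> augment A B \<in> carrier_mat n (k + m)"
  by (auto simp: augment_def)

lemma augment_index_left: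
  "A \<in> carrier_mat n k \<Longrightarrow> B \<in> carrier_mat n m \<Longrightarrow> i < n \<Longrightarrow> j < k \<Longrightarrow> augment A B $$ (i, j) = A $$ (i, j)"
  by (auto simp: augment_def)

lemma augment_index_right:
  "A \<in> carrier_mat n k \<Longrightarrow> B \<in> carrier_mat n m \<Longrightarrow> i < n \<Longrightarrow> j < m \<Longrightarrow> augment A B $$ (i, k + j) = B $$ (i, j)"
  by (auto simp: augment_def)

lemma augment_entry_cases:
  assumes A: "A \<in> carrier_mat n k" and B: "B \<in> carrier_mat n m"
    and i: "i < n" and j: "j < k + m"
  shows "(\<exists>l<k. augment A B $$ (i, j) = A $$ (i, l)) \<or> (\<exists>l<m. augment A B $$ (i, j) = B $$ (i, l))"
proof (cases "j < k")
  case True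
  then show ?thesis using augment_index_left[OF A B i] by blast
next
  case False
  then have "j - k < m" "k + (j - k) = j" using j by auto
  then show ?thesis using augment_index_right[OF A B i, of "j - k"] by metis
qed

lemma augment_inj:
  assumes "A \<in> carrier_mat n k" "B \<in> carrier_mat n m" "A' \<in> carrier_mat n k" "B' \<in> carrier_mat n m"
    and eq: "augment A B = augment A' B'"
  shows "A = A'" "B = B'"
proof -
  show "A = A'" 
    using assms augment_index_left[OF assms(1,2)] augment_index_left[OF assms(3,4)]
    by (intro eq_matI) auto
  show "B = B'" 
    using assms augment_index_right[OF assms(1,2)] augment_index_right[OF assms(3,4)]
    by (intro eq_matI) auto
qed

lemma flatten_mem_int_ball_iff:
  assumes A: "A \<in> carrier_mat n k" and N: "n * k > 0"
  shows "flatten_mat A \<in> int_ball (n * k) r \<longleftrightarrow> (\<forall>i<n. \<forall>j<k. \<bar>A $$ (i, j)\<bar> \<le> int r)"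
proof -
  have "(\<forall>l<n * k. \<bar>flatten_mat A $ l\<bar> \<le> int r) \<longleftrightarrow> (\<forall>i<n. \<forall>j<k. \<bar>A $$ (i, j)\<bar> \<le> int r)"
  proof
    assume L: "\<forall>l<n * k. \<bar>flatten_mat A $ l\<bar> \<le> int r"
    show "\<forall>i<n. \<forall>j<k. \<bar>A $$ (i, j)\<bar> \<le> int r"
      using L index_less_mult flatten_index[OF A] by metis
  next
    assume R: "\<forall>i<n. \<forall>j<k. \<bar>A $$ (i, j)\<bar> \<le> int r"
    show "\<forall>l<n * k. \<bar>flatten_mat A $ l\<bar> \<le> int r"
    proof (intro allI impI)
      fix l assume l: "l < n * k"
      then have "l div k < n" "l mod k < k" using N by (auto simp: less_mult_imp_div_less)
      moreover have "flatten_mat A $ l = A $$ (l div k, l mod k)"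
        using A l by (auto simp: flatten_mat_def)
      ultimately show "\<bar>flatten_mat A $ l\<bar> \<le> int r" using R by simp
    qed
  qed
  then show ?thesis using mem_int_ball_iff[OF N] flatten_carrier[OF A] by simp
qed

lemma unflatten_bounded:
  assumes N: "n * k > 0" and v: "v \<in> int_ball (n * k) r" and ij: "i < n" "j < k"
  shows "\<bar>unflatten n k v $$ (i, j)\<bar> \<le> int r"
  using v mem_int_ball_iff[OF N] index_less_mult[OF ij] ij by auto

text \<open>
  The factor \<open>(2 * r + 1) ^ (n * m)\<close> for the free choice of the right-hand side cancels against the
  larger box.
\<close>
lemma U_density_le_SAT_system_density:
  assumes pos: "m > 0" "k > 0" "n > 0"
  shows "ball_density (n * k) (U_set n k) r \<le> ball_density (n * (k + m)) (SAT_system m k n) r"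
proof -
  have N: "n * k > 0" "n * m > 0" "n * (k + m) > 0" using pos by auto
  define U where "U = U_set n k \<inter> int_ball (n * k) r"
  define S where "S = SAT_system m k n \<inter> int_ball (n * (k + m)) r"
  define B where "B = int_ball (n * m) r"
  let ?h = "\<lambda>(v, w). flatten_mat (augment (unflatten n k v) (unflatten n m w))"
  have carr: "v \<in> carrier_vec (n * k)" if "v \<in> U" for v using that unfolding U_def int_ball_def by auto
  have carr': "w \<in> carrier_vec (n * m)" if "w \<in> B" for w using that unfolding B_def int_ball_def by auto
  have "inj_on ?h (U \<times> B)"
  proof (rule inj_onI, clarify)
    fix v w v' w' assume mem: "v \<in> U" "w \<in> B" "v' \<in> U" "w' \<in> B"
      and "flatten_mat (augment (unflatten n k v) (unflatten n m w))
        = flatten_mat (augment (unflatten n k v') (unflatten n m w'))"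
    then have "augment (unflatten n k v) (unflatten n m w) = augment (unflatten n k v') (unflatten n m w')"
      by (metis unflatten_flatten augment_carrier unflatten_carrier)
    from augment_inj[OF unflatten_carrier unflatten_carrier unflatten_carrier unflatten_carrier this]
    have "flatten_mat (unflatten n k v) = flatten_mat (unflatten n k v')"
      "flatten_mat (unflatten n m w) = flatten_mat (unflatten n m w')" by simp_all
    then show "v = v' \<and> w = w'"
      using mem by (simp add: flatten_unflatten carr carr')
  qed
  moreover have "?h ` (U \<times> B) \<subseteq> S"
  proof clarify
    fix v w assume v: "v \<in> U" and w: "w \<in> B"
    let ?A = "unflatten n k v" and ?B = "unflatten n m w"
    have "Gcd (maximal_minors ?A) = 1" using v unfolding U_def by (simp add: U_set_iff)
    then obtain Y where Y: "Y \<in> carrier_mat k n" "?A * Y = 1\<^sub>m n"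
      by (rule unimodular_right_inverse[OF unflatten_carrier])
    have "?A * (Y * ?B) = ?B"
      using assoc_mult_mat[OF unflatten_carrier[of n k v] Y(1) unflatten_carrier[of n m w]] Y(2)
        left_mult_one_mat[OF unflatten_carrier[of n m w]] by simp
    then have "flatten_mat (augment ?A ?B) \<in> SAT_system m k n"
      unfolding SAT_system_def using Y(1)
      by (intro CollectI exI[of _ ?A] exI[of _ ?B] conjI bexI[of _ "Y * ?B"]) auto
    moreover have "flatten_mat (augment ?A ?B) \<in> int_ball (n * (k + m)) r"
      unfolding flatten_mem_int_ball_iff[OF augment_carrier[OF unflatten_carrier unflatten_carrier] N(3)]
    proof (intro allI impI)
      fix i j assume i: "i < n" and j: "j < k + m"
      have "\<bar>?A $$ (i, l)\<bar> \<le> int r" if "l < k" for l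
        using v i that unfolding U_def by (intro unflatten_bounded[OF N(1)]) auto
      moreover have "\<bar>?B $$ (i, l)\<bar> \<le> int r" if "l < m" for l
        using w i that unfolding B_def by (intro unflatten_bounded[OF N(2)]) auto
      ultimately show "\<bar>augment ?A ?B $$ (i, j)\<bar> \<le> int r"
        using augment_entry_cases[OF unflatten_carrier[of n k v] unflatten_carrier[of n m w] i j] by metis
    qed
    ultimately show "flatten_mat (augment ?A ?B) \<in> S" unfolding S_def by simp
  qed
  moreover have "finite S" unfolding S_def using finite_int_ball[OF N(3)] by simp
  ultimately have "card (U \<times> B) \<le> card S" by (rule card_inj_on_le)
  then have "card U * (2 * r + 1) ^ (n * m) \<le> card S"
    by (simp add: card_cartesian_product B_def card_int_ball[OF N(2)])
  then have "real (card U * (2 * r + 1) ^ (n * m)) \<le> real (card S)" by (simp only: of_nat_le_iff)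
  then have "real (card U) * real ((2 * r + 1) ^ (n * m)) / real ((2 * r + 1) ^ (n * (k + m)))
      \<le> real (card S) / real ((2 * r + 1) ^ (n * (k + m)))"
    by (intro divide_right_mono) (simp_all only: of_nat_mult of_nat_0_le_iff)
  moreover have "real (card U) * real ((2 * r + 1) ^ (n * m)) / real ((2 * r + 1) ^ (n * (k + m)))
      = real (card U) / real ((2 * r + 1) ^ (n * k))"
  proof -
    have "real ((2 * r + 1) ^ (n * (k + m))) = real ((2 * r + 1) ^ (n * k)) * real ((2 * r + 1) ^ (n * m))"
      by (simp only: distrib_left power_add of_nat_mult)
    moreover have "real ((2 * r + 1) ^ (n * m)) \<noteq> 0" by simp
    ultimately show ?thesis by (simp only: mult_divide_mult_cancel_right not_False_eq_True)
  qed
  ultimately show ?thesis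
    unfolding ball_density_def card_int_ball[OF N(1)] card_int_ball[OF N(3)] U_def S_def by simp
qed

lemma row_in_SAT_single:
  assumes A: "A \<in> carrier_mat n k" and B: "B \<in> carrier_mat n m" and X: "X \<in> carrier_mat k m"
    and eq: "A * X = B" and i: "i < n"
  shows "row (augment A B) i \<in> SAT_single m k"
proof -
  have "row (augment A B) i = vec (k + m) (\<lambda>j. augment A B $$ (i, j))"
    using A B i by (intro eq_vecI) (auto simp: augment_def)
  moreover have "Gcd ((\<lambda>j. augment A B $$ (i, j)) ` {..<k}) dvd augment A B $$ (i, k + l)"
    (is "?g dvd _") if l: "l < m" for l
  proof -
    have "augment A B $$ (i, k + l) = (A * X) $$ (i, l)" using augment_index_right[OF A B i l] eq by simp
    also have "\<dots> = (\<Sum>j = 0..<k. A $$ (i, j) * X $$ (j, l))"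
      using A X i l by (auto simp: scalar_prod_def intro!: sum.cong)
    also have "?g dvd \<dots>"
      using augment_index_left[OF A B i] by (intro dvd_sum dvd_mult2 Gcd_dvd) (auto intro!: image_eqI)
    finally show ?thesis .
  qed
  ultimately show ?thesis using SAT_single_iff by simp
qed

lemma SAT_system_density_le_SAT_single_density_power:
  assumes pos: "m > 0" "n > 0"
  shows "ball_density (n * (k + m)) (SAT_system m k n) r
    \<le> ball_density (k + m) (SAT_single m k) r ^ n"
proof -
  have N: "k + m > 0" "n * (k + m) > 0" using pos by auto
  define S where "S = SAT_system m k n \<inter> int_ball (n * (k + m)) r"
  define T where "T = SAT_single m k \<inter> int_ball (k + m) r"
  let ?h = "\<lambda>v. restrict (\<lambda>i. row (unflatten n (k + m) v) i) {..<n}"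
  have carr: "v \<in> carrier_vec (n * (k + m))" if "v \<in> S" for v using that unfolding S_def int_ball_def by auto
  have "inj_on ?h S"
  proof (rule inj_onI)
    fix v v' assume mem: "v \<in> S" "v' \<in> S" and eq: "?h v = ?h v'"
    have "unflatten n (k + m) v = unflatten n (k + m) v'"
    proof (rule eq_rowI)
      fix i assume "i < dim_row (unflatten n (k + m) v')"
      then show "row (unflatten n (k + m) v) i = row (unflatten n (k + m) v') i"
        using fun_cong[OF eq, of i] by simp
    qed auto
    then have "flatten_mat (unflatten n (k + m) v) = flatten_mat (unflatten n (k + m) v')" by simp
    then show "v = v'" using mem by (simp add: flatten_unflatten carr)
  qed
  moreover have "?h ` S \<subseteq> {..<n} \<rightarrow>\<^sub>E T"
  proof (intro subsetI, elim imageE, clarify)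
    fix v assume v: "v \<in> S"
    then obtain A B X where AB: "A \<in> carrier_mat n k" "B \<in> carrier_mat n m"
      and X: "X \<in> carrier_mat k m" "A * X = B" and veq: "v = flatten_mat (augment A B)"
      unfolding S_def SAT_system_def by auto
    have "row (unflatten n (k + m) v) i \<in> T" if i: "i < n" for i
    proof -
      have "unflatten n (k + m) v = augment A B"
        unfolding veq by (rule unflatten_flatten[OF augment_carrier[OF AB]])
      then have "row (unflatten n (k + m) v) i \<in> SAT_single m k"
        using row_in_SAT_single[OF AB X i] by simp
      moreover have "row (unflatten n (k + m) v) i \<in> int_ball (k + m) r"
        unfolding mem_int_ball_iff[OF N(1)]
        using unflatten_bounded[OF N(2) _ i, of v r] v i unfolding S_def by auto
      ultimately show ?thesis unfolding T_def by simp
    qed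
    then show "?h v \<in> {..<n} \<rightarrow>\<^sub>E T" by auto
  qed
  moreover have "finite ({..<n} \<rightarrow>\<^sub>E T)"
    unfolding T_def using finite_int_ball[OF N(1)] by (intro finite_PiE) auto
  ultimately have "card S \<le> card ({..<n} \<rightarrow>\<^sub>E T)" by (rule card_inj_on_le)
  then have "card S \<le> card T ^ n" by (simp add: card_PiE)
  then have "real (card S) \<le> real (card T ^ n)" by (simp only: of_nat_le_iff)
  then have "real (card S) / real ((2 * r + 1) ^ (n * (k + m))) \<le> real (card T ^ n) / real ((2 * r + 1) ^ (n * (k + m)))"
    by (intro divide_right_mono) simp_all
  also have "\<dots> = (real (card T) / real ((2 * r + 1) ^ (k + m))) ^ n"
    by (simp add: power_divide power_mult mult.commute[of n])
  finally show ?thesis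
    unfolding ball_density_def card_int_ball[OF N(1)] card_int_ball[OF N(2)] S_def T_def .
qed

section \<open>The limits\<close>

lemma asymp_density_limit:
  "convergent (ball_density N M) \<Longrightarrow> ball_density N M \<longlonglongrightarrow> asymp_density N M"
  unfolding asymp_density_def by (simp add: convergent_LIMSEQ_iff)

theorem theorem5p10:
  fixes m k n :: nat
  assumes "m > 0" and "k > 0" and "n > 0"
  shows "(k > n \<and> n > 1 \<longrightarrow>
           ereal (asymp_density (n * k) (U_set n k))
             \<le> lower_asymp_density (n * (k + m)) (SAT_system m k n))
       \<and> (k \<ge> n \<and> n > 1 \<longrightarrow>
           upper_asymp_density (n * (k + m)) (SAT_system m k n)
             \<le> ereal (asymp_density (k + m) (SAT_single m k) ^ n))"
proof (intro conjI impI)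
  assume nk: "k > n \<and> n > 1"
  let ?U = "\<lambda>r. ereal (ball_density (n * k) (U_set n k) r)"
  have "?U \<longlonglongrightarrow> ereal (asymp_density (n * k) (U_set n k))"
    using U_density_convergent[of n k] nk by (simp add: asymp_density_limit)
  then have "ereal (asymp_density (n * k) (U_set n k)) = liminf ?U"
    by (rule lim_imp_Liminf[OF sequentially_bot, symmetric])
  also have "\<dots> \<le> lower_asymp_density (n * (k + m)) (SAT_system m k n)"
    unfolding lower_asymp_density_def
    by (intro Liminf_mono always_eventually allI)
      (simp add: U_density_le_SAT_system_density[OF assms])
  finally show "ereal (asymp_density (n * k) (U_set n k))
      \<le> lower_asymp_density (n * (k + m)) (SAT_system m k n)" .
next
  assume nk: "k \<ge> n \<and> n > 1"
  let ?T = "\<lambda>r. ereal (ball_density (k + m) (SAT_single m k) r ^ n)"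
  have "ball_density (k + m) (SAT_single m k) \<longlonglongrightarrow> asymp_density (k + m) (SAT_single m k)"
    using nk by (intro asymp_density_limit SAT_single_density_convergent) simp
  then have "?T \<longlonglongrightarrow> ereal (asymp_density (k + m) (SAT_single m k) ^ n)"
    by (intro tendsto_ereal tendsto_power)
  then have lim: "limsup ?T = ereal (asymp_density (k + m) (SAT_single m k) ^ n)"
    by (rule lim_imp_Limsup[OF sequentially_bot])
  have "upper_asymp_density (n * (k + m)) (SAT_system m k n) \<le> limsup ?T"
    unfolding upper_asymp_density_def
    by (intro Limsup_mono always_eventually allI)
      (simp add: SAT_system_density_le_SAT_single_density_power[OF assms(1,3)] del: ereal_power)
  then show "upper_asymp_density (n * (k + m)) (SAT_system m k n)
      \<le> ereal (asymp_density (k + m) (SAT_single m k) ^ n)"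
    unfolding lim .
qed

end
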